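(* There exist universal constants $c,c'>0$ such that the following holds. Let $n\in\mathbb{N}$, $\sigma^2>0$, $0<\tau_1\le\dots\le\tau_n$, $L,\Delta>0$, $0<\varepsilon\le c'L\Delta$. Let $A=\{A_d\}_{d\in\mathbb{N}}$ be a family of zero-respecting algorithms for the time oracle protocol. Then there exist $d$, $f\in\mathcal{F}_{\Delta,L}$ on $\mathbb{R}^d$ and an admissible choice $(O,\mathcal{D})\in\mathcal{O}^{\sigma^2,\mathrm{sync}}_{\tau_1,\dots,\tau_n}(f)$ such that $$\mathbb{E}\Big[\inf_{k\in S_t}\|\nabla f(x^k)\|^2\Big]>\varepsilon\quad\text{for}\quad t=c\cdot\min_{m\in[n]}\left[\tau_m\Big(\frac{L\Delta}{\varepsilon}+\frac{\sigma^2L\Delta}{m\varepsilon^2}\Big)\right].$$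
   Context: Notation: $[n]=\{1,\dots,n\}$, $\mathbb{N}_0=\{0,1,\dots\}$, $\mathrm{supp}(x)=\{i:x_i\ne0\}$. Time oracle protocol (single oracle). An algorithm is $A^0\in\mathbb{R}_{\ge0}\times\mathbb{R}^d$ and $A^k:(\mathbb{R}^d)^k\to\mathbb{R}_{\ge0}\times\mathbb{R}^d$ ($k\ge1$) such that the first (time) component of $A^k(g^1,\dots,g^k)$ is at least that of $A^{k-1}(g^1,\dots,g^{k-1})$. Set $t^0=0$ and oracle state $s^0=(0,0,0)\in\mathbb{R}_{\ge0}\times\mathbb{R}^d\times\{0,1\}$. For $k=0,1,\dots$: $(t^{k+1},x^k)=A^k(g^1,\dots,g^k)$; draw $\xi^{k+1}=(\xi^{k+1}_1,\dots,\xi^{k+1}_n)\sim\mathcal{D}$ independently of the past; $(s^{k+1},g^{k+1})=O(t^{k+1},x^k,s^k,\xi^{k+1})$. $S_t=\{k\in\mathbb{N}_0:t^k\le t\}$. Zero-respecting: $\mathrm{supp}(x^k)\subseteq\bigcup_{j=1}^k\mathrm{supp}(g^j)$ for all $k$ and all realizations. Synchronized oracle: for a mapping $G:\mathbb{R}^d\times\mathbb{S}_\xi\to\mathbb{R}^d$, $O^G_{\tau_1,\dots,\tau_n}(t,x,(s_t,s_x,s_q),(\xi_1,\dots,\xi_n))$ returns $((t,x,1),0)$ if $s_q=0$, and if $s_q=1$ returns $\big((0,0,0),\sum_{i\in[n]:\,s_t+\tau_i\le t}G(s_x;\xi_i)\big)$ (empty sum $=0$). Function class $\mathcal{F}_{\Delta,L}$: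 differentiable $f:\mathbb{R}^d\to\mathbb{R}$ with $\|\nabla f(x)-\nabla f(y)\|\le L\|x-y\|$ and $f(0)-\inf f\le\Delta$. Oracle class $\mathcal{O}^{\sigma^2,\mathrm{sync}}_{\tau_1,\dots,\tau_n}(f)$: an admissible choice is a sample space $\mathbb{S}_\xi$, a distribution $\mathcal{D}_0$ on it, and a mapping $G$ with $\mathbb{E}_{\xi\sim\mathcal{D}_0}[G(x;\xi)]=\nabla f(x)$, $\mathbb{E}_{\xi\sim\mathcal{D}_0}\|G(x;\xi)-\nabla f(x)\|^2\le\sigma^2$ for all $x$; then $\mathcal{D}=\mathcal{D}_0^{\otimes n}$ and $O=O^G_{\tau_1,\dots,\tau_n}$. *)

theory Defs
  imports "HOL-Probability.Probability"
begin

text \<open>Vectors of R^d are represented as functions nat => real vanishing at all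
  indices >= d (coordinates 0..d-1). The dimension d varies, so a type-indexed
  Euclidean space cannot be used.\<close>

type_synonym vec = "nat \<Rightarrow> real"

definition Rd :: "nat \<Rightarrow> vec set" where
  "Rd d = {x. \<forall>i\<ge>d. x i = 0}"

definition ipd :: "nat \<Rightarrow> vec \<Rightarrow> vec \<Rightarrow> real" where
  "ipd d x y = (\<Sum>i<d. x i * y i)"

definition normd :: "nat \<Rightarrow> vec \<Rightarrow> real" where
  "normd d x = sqrt (\<Sum>i<d. (x i)^2)"

definition supp :: "vec \<Rightarrow> nat set" where
  "supp x = {i. x i \<noteq> 0}"

definition zerov :: vec where "zerov = (\<lambda>_. 0)"

definition is_gradient_on :: "nat \<Rightarrow> (vec \<Rightarrow> real) \<Rightarrow> (vec \<Rightarrow> vec) \<Rightarrow> bool" where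
  "is_gradient_on d f g \<longleftrightarrow>
     (\<forall>x\<in>Rd d. g x \<in> Rd d \<and>
        (\<forall>e>0. \<exists>\<delta>>0. \<forall>y\<in>Rd d. normd d (\<lambda>i. y i - x i) < \<delta> \<longrightarrow>
           \<bar>f y - f x - ipd d (g x) (\<lambda>i. y i - x i)\<bar> \<le> e * normd d (\<lambda>i. y i - x i)))"

definition F_class :: "nat \<Rightarrow> real \<Rightarrow> real \<Rightarrow> (vec \<Rightarrow> real) \<Rightarrow> (vec \<Rightarrow> vec) \<Rightarrow> bool" where
  "F_class d \<Delta> L f g \<longleftrightarrow>
     is_gradient_on d f g \<and>
     (\<forall>x\<in>Rd d. \<forall>y\<in>Rd d. normd d (\<lambda>i. g x i - g y i) \<le> L * normd d (\<lambda>i. x i - y i)) \<and>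
     (\<forall>x\<in>Rd d. f zerov - f x \<le> \<Delta>)"

definition admissible_oracle ::
  "nat \<Rightarrow> real \<Rightarrow> (vec \<Rightarrow> vec) \<Rightarrow> real measure \<Rightarrow> (vec \<Rightarrow> real \<Rightarrow> vec) \<Rightarrow> bool" where
  "admissible_oracle d \<sigma>2 g D0 G \<longleftrightarrow>
     prob_space D0 \<and>
     (\<forall>x\<in>Rd d.
        (\<forall>\<xi>\<in>space D0. G x \<xi> \<in> Rd d) \<and>
        (\<forall>i<d. integrable D0 (\<lambda>\<xi>. G x \<xi> i) \<and> (\<integral>\<xi>. G x \<xi> i \<partial>D0) = g x i) \<and>
        integrable D0 (\<lambda>\<xi>. (normd d (\<lambda>i. G x \<xi> i - g x i))^2) \<and>
        (\<integral>\<xi>. (normd d (\<lambda>i. G x \<xi> i - g x i))^2 \<partial>D0) \<le> \<sigma>2)"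

definition sync_oracle ::
  "(vec \<Rightarrow> real \<Rightarrow> vec) \<Rightarrow> nat \<Rightarrow> (nat \<Rightarrow> real) \<Rightarrow> real \<Rightarrow> vec \<Rightarrow> real \<times> vec \<times> bool
     \<Rightarrow> (nat \<Rightarrow> real) \<Rightarrow> (real \<times> vec \<times> bool) \<times> vec" where
  "sync_oracle G n \<tau> t x s \<xi> =
     (case s of (st, sx, sq) \<Rightarrow>
        if \<not> sq then ((t, x, True), zerov)
        else ((0, zerov, False),
              (\<lambda>j. \<Sum>i\<in>{i\<in>{1..n}. st + \<tau> i \<le> t}. G sx (\<xi> i) j)))"

text \<open>An algorithm: the list [g^1,...,g^k] is mapped to (t^{k+1}, x^k).\<close>
type_synonym alg = "vec list \<Rightarrow> real \<times> vec"

definition is_algorithm :: "nat \<Rightarrow> alg \<Rightarrow> bool" where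
  "is_algorithm d A \<longleftrightarrow>
     (\<forall>gs. set gs \<subseteq> Rd d \<longrightarrow> fst (A gs) \<ge> 0 \<and> snd (A gs) \<in> Rd d) \<and>
     (\<forall>gs g. set gs \<subseteq> Rd d \<and> g \<in> Rd d \<longrightarrow> fst (A gs) \<le> fst (A (gs @ [g])))"

definition zero_respecting :: "nat \<Rightarrow> alg \<Rightarrow> bool" where
  "zero_respecting d A \<longleftrightarrow>
     (\<forall>gs. set gs \<subseteq> Rd d \<longrightarrow> supp (snd (A gs)) \<subseteq> (\<Union>g\<in>set gs. supp g))"

text \<open>Run of the protocol. omega k i = xi^k_i (only k >= 1, 1 <= i <= n are used).
  After k steps: the received gradients [g^1..g^k] and oracle state s^k.\<close>
fun run :: "alg \<Rightarrow> (vec \<Rightarrow> real \<Rightarrow> vec) \<Rightarrow> nat \<Rightarrow> (nat \<Rightarrow> real) \<Rightarrow> (nat \<Rightarrow> nat \<Rightarrow> real)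
             \<Rightarrow> nat \<Rightarrow> vec list \<times> (real \<times> vec \<times> bool)" where
  "run A G n \<tau> \<omega> 0 = ([], (0, zerov, False))"
| "run A G n \<tau> \<omega> (Suc k) =
     (let (gs, s) = run A G n \<tau> \<omega> k;
          (t', x) = A gs;
          (s', g) = sync_oracle G n \<tau> t' x s (\<omega> (Suc k))
      in (gs @ [g], s'))"

definition iterate_x :: "alg \<Rightarrow> (vec \<Rightarrow> real \<Rightarrow> vec) \<Rightarrow> nat \<Rightarrow> (nat \<Rightarrow> real) \<Rightarrow> (nat \<Rightarrow> nat \<Rightarrow> real) \<Rightarrow> nat \<Rightarrow> vec" where
  "iterate_x A G n \<tau> \<omega> k = snd (A (fst (run A G n \<tau> \<omega> k)))"

definition iterate_t :: "alg \<Rightarrow> (vec \<Rightarrow> real \<Rightarrow> vec) \<Rightarrow> nat \<Rightarrow> (nat \<Rightarrow> real) \<Rightarrow> (nat \<Rightarrow> nat \<Rightarrow> real) \<Rightarrow> nat \<Rightarrow> real" where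
  "iterate_t A G n \<tau> \<omega> k = (if k = 0 then 0 else fst (A (fst (run A G n \<tau> \<omega> (k - 1)))))"

definition noise_space :: "real measure \<Rightarrow> (nat \<Rightarrow> nat \<Rightarrow> real) measure" where
  "noise_space D0 = PiM UNIV (\<lambda>_. PiM UNIV (\<lambda>_. D0))"

text \<open>E[ inf_{k in S_t} ||grad f(x^k)||^2 ] as a (lower) nonnegative integral.\<close>
definition expected_inf_sqgrad ::
  "nat \<Rightarrow> alg \<Rightarrow> (vec \<Rightarrow> vec) \<Rightarrow> real measure \<Rightarrow> (vec \<Rightarrow> real \<Rightarrow> vec) \<Rightarrow> nat \<Rightarrow> (nat \<Rightarrow> real) \<Rightarrow> real \<Rightarrow> ennreal" where
  "expected_inf_sqgrad d A g D0 G n \<tau> t =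
     (\<integral>\<^sup>+ \<omega>. ennreal (INF k\<in>{k. iterate_t A G n \<tau> \<omega> k \<le> t}. (normd d (g (iterate_x A G n \<tau> \<omega> k)))^2)
        \<partial>noise_space D0)"

end

theory Submission
  imports Defs
begin

text \<open>
  The hard function is a scaled chain: its gradient is large until the last coordinate is nonzero,
  and a point supported on the first \<open>m\<close> coordinates has a gradient supported on the first
  \<open>m + 1\<close>. The stochastic gradient hides the new coordinate behind a coin of bias
  \<open>p \<approx> \<epsilon> / \<sigma>\<^sup>2\<close>, so an answer of \<open>m\<close> workers reveals a coordinate with probability at most
  \<open>min 1 (m p)\<close> and takes time at least \<open>\<tau>\<^sub>m\<close>. If \<open>\<rho>\<close> is the best ratio of these two quantities, then
  the expected number of coordinates discovered up to time \<open>t\<close> is at most \<open>\<rho> t\<close>. Since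
  \<open>1 / \<rho>\<close> is comparable to the minimum of \<open>\<tau>\<^sub>m (1 + \<sigma>\<^sup>2 / (m \<epsilon>))\<close>, Markov's inequality shows that all
  \<open>T \<approx> L \<Delta> / \<epsilon>\<close> coordinates are discovered in time with probability at most one half.
\<close>

section \<open>The chain function\<close>

definition unit_clamp :: "real \<Rightarrow> real" where
  "unit_clamp x = max 0 (min 1 x)"

text \<open>The cubic Hermite step: its slope vanishes at both ends of \<open>[0, 1]\<close>, so the
  extension by constants is \<open>C^1\<close> with Lipschitz derivative.\<close>

definition smooth_step :: "real \<Rightarrow> real" where
  "smooth_step x = 3 * (unit_clamp x)^2 - 2 * (unit_clamp x)^3"

definition smooth_step' :: "real \<Rightarrow> real" where
  "smooth_step' x = 6 * unit_clamp x * (1 - unit_clamp x)"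

text \<open>The step is stretched over \<open>[-1, 2]\<close> so that the slope is bounded away from
  0 on \<open>[-1/2, 1]\<close>, in particular at an undiscovered coordinate.\<close>

definition ramp :: "real \<Rightarrow> real" where
  "ramp x = smooth_step ((x + 1) / 3)"

definition ramp' :: "real \<Rightarrow> real" where
  "ramp' x = smooth_step' ((x + 1) / 3) / 3"

text \<open>A one-sided Huber function: 0 for \<open>x \<ge> 0\<close>, \<open>x^2 / 2\<close> on
  \<open>[-1, 0]\<close> and \<open>- x - 1/2\<close> below. The linear tail keeps the gradient
  bounded.\<close>

definition penalty :: "real \<Rightarrow> real" where
  "penalty x = - unit_clamp (- x) * x - (unit_clamp (- x))^2 / 2"

definition penalty' :: "real \<Rightarrow> real" where
  "penalty' x = - unit_clamp (- x)"

section \<open>Bounds for the cubic step\<close>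

lemma unit_clamp_bounds: "0 \<le> unit_clamp x" "unit_clamp x \<le> 1"
  by (auto simp: unit_clamp_def)

lemma unit_clamp_lipschitz: "\<bar>unit_clamp x - unit_clamp y\<bar> \<le> \<bar>x - y\<bar>"
  by (auto simp: unit_clamp_def max_def min_def)

lemma unit_prod_bounds:
  fixes u :: real assumes "0 \<le> u" "u \<le> 1"
  shows "0 \<le> u * (1 - u)" "u * (1 - u) \<le> 1/4"
proof -
  show "0 \<le> u * (1 - u)" using assms by simp
  have "(u - 1/2)^2 \<ge> 0" by simp
  then show "u * (1 - u) \<le> 1/4" by (simp add: power2_eq_square algebra_simps)
qed

lemma smooth_step_bounds: "0 \<le> smooth_step x" "smooth_step x \<le> 1"
proof -
  define u where "u = unit_clamp x"
  have u: "0 \<le> u" "u \<le> 1" by (auto simp: u_def unit_clamp_bounds)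
  have "smooth_step x = u^2 * (3 - 2 * u)"
    by (simp add: smooth_step_def u_def power2_eq_square power3_eq_cube algebra_simps)
  then show "0 \<le> smooth_step x" using u by simp
  have "1 - smooth_step x = (1 - u)^2 * (1 + 2 * u)"
    by (simp add: smooth_step_def u_def power2_eq_square power3_eq_cube algebra_simps)
  moreover have "(1 - u)^2 * (1 + 2 * u) \<ge> 0" using u by simp
  ultimately show "smooth_step x \<le> 1" by linarith
qed

lemma smooth_step'_bounds: "0 \<le> smooth_step' x" "smooth_step' x \<le> 3/2"
  using unit_prod_bounds[OF unit_clamp_bounds, of x] by (auto simp: smooth_step'_def)

lemma smooth_step_0 [simp]: "smooth_step 0 = 0" "smooth_step' 0 = 0"
  by (simp_all add: smooth_step_def smooth_step'_def unit_clamp_def)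

lemma smooth_step_ge1: "x \<ge> 1 \<Longrightarrow> smooth_step x = 1"
  by (simp add: smooth_step_def unit_clamp_def)

lemma smooth_step'_lipschitz: "\<bar>smooth_step' x - smooth_step' y\<bar> \<le> 6 * \<bar>x - y\<bar>"
proof -
  define u v where "u = unit_clamp x" and "v = unit_clamp y"
  have uv: "0 \<le> u" "u \<le> 1" "0 \<le> v" "v \<le> 1" by (auto simp: u_def v_def unit_clamp_bounds)
  have "smooth_step' x - smooth_step' y = 6 * ((u - v) * (1 - u - v))"
    by (simp add: smooth_step'_def u_def v_def algebra_simps)
  then have "\<bar>smooth_step' x - smooth_step' y\<bar> = 6 * (\<bar>u - v\<bar> * \<bar>1 - u - v\<bar>)"
    by (simp add: abs_mult)
  also have "\<dots> \<le> 6 * (\<bar>x - y\<bar> * 1)"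
    using uv unit_clamp_lipschitz[of x y]
    by (intro mult_left_mono mult_mono) (auto simp: u_def v_def)
  finally show ?thesis by simp
qed

text \<open>The divided difference \<open>q\<close> of the cubic lies in \<open>[0, 3/2]\<close>:
  from above by completing squares, from below as a sum of nonnegative products.\<close>

lemma smooth_step_lipschitz: "\<bar>smooth_step x - smooth_step y\<bar> \<le> 3/2 * \<bar>x - y\<bar>"
proof -
  define u v where "u = unit_clamp x" and "v = unit_clamp y"
  have uv: "0 \<le> u" "u \<le> 1" "0 \<le> v" "v \<le> 1" by (auto simp: u_def v_def unit_clamp_bounds)
  define q where "q = 3 * (u + v) - 2 * (u^2 + u * v + v^2)"
  have "2 * q = 3 - (3 * (u + v - 1)^2 + (u - v)^2)"
    by (simp add: q_def power2_eq_square algebra_simps)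
  then have q1: "q \<le> 3/2" using zero_le_power2[of "u + v - 1"] zero_le_power2[of "u - v"] by linarith
  have "q = 2 * (u * (1 - u)) + 2 * (v * (1 - v)) + u * (1 - v) + v * (1 - u)"
    by (simp add: q_def power2_eq_square algebra_simps)
  then have q0: "q \<ge> 0" using uv by simp
  have "smooth_step x - smooth_step y = (u - v) * q"
    by (simp add: smooth_step_def u_def v_def q_def power2_eq_square power3_eq_cube algebra_simps)
  then have "\<bar>smooth_step x - smooth_step y\<bar> = \<bar>u - v\<bar> * q"
    using q0 by (simp add: abs_mult)
  also have "\<dots> \<le> \<bar>x - y\<bar> * (3/2)"
    using unit_clamp_lipschitz[of x y] q0 q1 by (intro mult_mono) (auto simp: u_def v_def)
  finally show ?thesis by simp
qed

text \<open>The error splits into the exact remainder of the cubic in the clamped values (constant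
  3) and the effect of clamping on the linear term (constant 6).\<close>

lemma smooth_step_taylor:
  "\<bar>smooth_step y - smooth_step x - smooth_step' x * (y - x)\<bar> \<le> 9 * (y - x)^2"
proof -
  define u v where "u = unit_clamp x" and "v = unit_clamp y"
  have uv: "0 \<le> u" "u \<le> 1" "0 \<le> v" "v \<le> 1" by (auto simp: u_def v_def unit_clamp_bounds)
  have "\<bar>(v - u)^2 * (3 - 2 * v - 4 * u)\<bar> = (v - u)^2 * \<bar>3 - 2 * v - 4 * u\<bar>"
    by (simp add: abs_mult)
  also have "\<dots> \<le> (y - x)^2 * 3"
    using uv unit_clamp_lipschitz[of y x]
    by (intro mult_mono) (auto simp: u_def v_def abs_le_square_iff)
  finally have 1: "\<bar>(v - u)^2 * (3 - 2 * v - 4 * u)\<bar> \<le> 3 * (y - x)^2" by simp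
  have 2: "\<bar>6 * u * (1 - u) * ((y - x) - (v - u))\<bar> \<le> 6 * (y - x)^2"
  proof (cases "0 < x \<and> x < 1 \<and> (y < 0 \<or> 1 < y)")
    case False
    then have "u = 0 \<or> u = 1 \<or> y - x = v - u"
      by (auto simp: u_def v_def unit_clamp_def max_def min_def)
    then show ?thesis by auto
  next
    case True
    then have u: "u = x" "0 < x" "x < 1" by (auto simp: u_def unit_clamp_def)
    \<comment> \<open>\<open>u * (1 - u)\<close> is at most the distance from \<open>x\<close> to
      the end of \<open>[0, 1]\<close> that \<open>y\<close> has passed; this supplies the second
      order.\<close>
    have "u * (1 - u) * \<bar>(y - x) - (v - u)\<bar> \<le> \<bar>y - x\<bar> * \<bar>y - x\<bar>"
    proof (cases "y < 0")
      case True
      then have v: "v = 0" by (simp add: v_def unit_clamp_def)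
      have "u * (1 - u) \<le> u * 1" using u by (intro mult_left_mono) auto
      also have "\<dots> \<le> \<bar>y - x\<bar>" using u True by simp
      finally show ?thesis using u v True by (intro mult_mono) auto
    next
      case False
      with True have y: "y > 1" by simp
      then have v: "v = 1" by (simp add: v_def unit_clamp_def)
      have "u * (1 - u) \<le> 1 * (1 - u)" using u by (intro mult_right_mono) auto
      also have "\<dots> \<le> \<bar>y - x\<bar>" using u y by simp
      finally show ?thesis using u v y by (intro mult_mono) auto
    qed
    then show ?thesis using u by (simp add: abs_mult power2_eq_square)
  qed
  have "smooth_step y - smooth_step x - smooth_step' x * (y - x)
      = (v - u)^2 * (3 - 2 * v - 4 * u) - 6 * u * (1 - u) * ((y - x) - (v - u))"
    by (simp add: smooth_step_def smooth_step'_def u_def v_def power2_eq_square power3_eq_cube algebra_simps)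
  then show ?thesis using 1 2 by linarith
qed

section \<open>Bounds for the ramp and the penalty\<close>

lemma ramp_bounds: "0 \<le> ramp x" "ramp x \<le> 1" "0 \<le> ramp' x" "ramp' x \<le> 1/2"
  using smooth_step_bounds[of "(x+1)/3"] smooth_step'_bounds[of "(x+1)/3"]
  by (auto simp: ramp_def ramp'_def)

lemma ramp_lipschitz: "\<bar>ramp x - ramp y\<bar> \<le> 1/2 * \<bar>x - y\<bar>"
  using smooth_step_lipschitz[of "(x+1)/3" "(y+1)/3"]
  by (simp add: ramp_def diff_divide_distrib[symmetric] abs_divide)

lemma ramp'_lipschitz: "\<bar>ramp' x - ramp' y\<bar> \<le> 2/3 * \<bar>x - y\<bar>"
  using smooth_step'_lipschitz[of "(x+1)/3" "(y+1)/3"]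
  by (simp add: ramp'_def diff_divide_distrib[symmetric] abs_divide)

lemma ramp_taylor: "\<bar>ramp y - ramp x - ramp' x * (y - x)\<bar> \<le> (y - x)^2"
proof -
  have e: "(y + 1) / 3 - (x + 1) / 3 = (y - x) / 3" by (simp add: field_simps)
  show ?thesis
    using smooth_step_taylor[of "(y+1)/3" "(x+1)/3"] unfolding e ramp_def ramp'_def
    by (simp add: power_divide)
qed

lemma ramp'_ge: assumes "- 1/2 \<le> x" "x \<le> 1" shows "ramp' x \<ge> 1/4"
proof -
  define u where "u = (x + 1) / 3"
  have u: "1/6 \<le> u" "u \<le> 2/3" using assms by (auto simp: u_def)
  \<comment> \<open>\<open>1/9 + u / 6\<close> is the chord of the concave function
    \<open>u * (1 - u)\<close> over \<open>[1/6, 2/3]\<close>.\<close>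
  then have "(u - 1/6) * (2/3 - u) \<ge> 0" by simp
  then have "u * (1 - u) \<ge> 1/9 + u / 6" by (simp add: algebra_simps)
  moreover have "ramp' x = 2 * (u * (1 - u))"
    using u by (simp add: ramp'_def smooth_step'_def u_def[symmetric] unit_clamp_def)
  ultimately show ?thesis using u by linarith
qed

lemma penalty_nonneg: "0 \<le> penalty x"
proof -
  consider "x \<ge> 0" | "-1 \<le> x" "x < 0" | "x < -1" by linarith
  then show ?thesis
    by cases (auto simp: penalty_def unit_clamp_def max_def min_def power2_eq_square)
qed

lemma penalty_0 [simp]: "penalty 0 = 0" "penalty' 0 = 0"
  by (simp_all add: penalty_def penalty'_def unit_clamp_def)

lemma penalty'_bounds: "-1 \<le> penalty' x" "penalty' x \<le> 0"
  by (simp_all add: penalty'_def unit_clamp_bounds)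

lemma penalty'_lipschitz: "\<bar>penalty' x - penalty' y\<bar> \<le> \<bar>x - y\<bar>"
  using unit_clamp_lipschitz[of "-y" "-x"] by (simp add: penalty'_def)

lemma penalty'_le: "x \<le> -1/2 \<Longrightarrow> penalty' x \<le> -1/2"
  by (simp add: penalty'_def unit_clamp_def)

lemma penalty_taylor: "\<bar>penalty y - penalty x - penalty' x * (y - x)\<bar> \<le> (y - x)^2"
proof -
  define u v where "u = unit_clamp (- x)" and "v = unit_clamp (- y)"
  have "\<bar>v - u\<bar> * \<bar>y + (u + v) / 2\<bar> \<le> \<bar>y - x\<bar> * \<bar>y - x\<bar>"
  proof (cases "u = v")
    case False
    \<comment> \<open>Different clamped values exclude two points on the same constant piece, where
      this factor is not controlled by the distance.\<close>
    then have "\<bar>2 * y + (u + v)\<bar> \<le> 2 * \<bar>y - x\<bar>"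
      by (auto simp: u_def v_def unit_clamp_def max_def min_def split: if_splits)
    then have "\<bar>y + (u + v) / 2\<bar> \<le> \<bar>y - x\<bar>" by (simp add: abs_if field_simps split: if_splits)
    then show ?thesis using unit_clamp_lipschitz[of "-y" "-x"]
      by (intro mult_mono) (auto simp: u_def v_def)
  qed simp
  moreover have "penalty y - penalty x - penalty' x * (y - x) = - ((v - u) * (y + (u + v) / 2))"
    by (simp add: penalty_def penalty'_def u_def v_def power2_eq_square algebra_simps add_divide_distrib diff_divide_distrib)
  ultimately show ?thesis by (simp add: abs_mult power2_eq_square)
qed

text \<open>The value 1 in front of coordinate 0 makes the first link active from the start, since
  \<open>smooth_step 1 = 1\<close>.\<close>

definition prev :: "vec \<Rightarrow> nat \<Rightarrow> real" where
  "prev x j = (if j = 0 then 1 else x (j - 1))"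

text \<open>A chain of Carmon, Duchi, Hinder and Sidford, with a \<open>C\<^sup>1\<close> spline in place of the smooth bump
  functions. At the first \<open>j\<close> with \<open>x j < 1\<close>, the ramp (for \<open>x j \<ge> -1/2\<close>) or the penalty
  (for \<open>x j \<le> -1/2\<close>) brings the \<open>j\<close>-th partial derivative down to \<open>-1/4\<close>; no term can cancel it,
  since all contributions to a partial derivative are nonpositive.\<close>
definition chain :: "nat \<Rightarrow> vec \<Rightarrow> real" where
  "chain T x = (\<Sum>j<T. penalty (x j) - smooth_step (prev x j) * ramp (x j))"

text \<open>Coordinate \<open>j\<close> occurs in summand \<open>j\<close> and, as a predecessor, in
  summand \<open>j + 1\<close>, which is missing for the last coordinate.\<close>

definition chain' :: "nat \<Rightarrow> vec \<Rightarrow> vec" where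
  "chain' T x j = (if j < T
     then penalty' (x j) - smooth_step (prev x j) * ramp' (x j)
          - (if Suc j < T then smooth_step' (x j) * ramp (x (Suc j)) else 0)
     else 0)"

section \<open>Taylor expansion of the chain\<close>

lemma sum_prev_le:
  fixes w :: "nat \<Rightarrow> real" assumes "\<And>j. w j \<ge> 0"
  shows "(\<Sum>j<T. if j = 0 then 0 else w (j - 1)) \<le> (\<Sum>j<T. w j)"
proof (cases T)
  case (Suc T')
  then have "(\<Sum>j<T. if j = 0 then 0 else w (j - 1)) = (\<Sum>j<T'. w j)"
    by (simp add: sum.lessThan_Suc_shift del: sum.lessThan_Suc)
  then show ?thesis using assms Suc by simp
qed simp

lemma sum_next_le:
  fixes w :: "nat \<Rightarrow> real" assumes "\<And>j. w j \<ge> 0"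
  shows "(\<Sum>j<T. if Suc j < T then w (Suc j) else 0) \<le> (\<Sum>j<T. w j)"
proof (cases T)
  case (Suc T')
  then have "(\<Sum>j<T. if Suc j < T then w (Suc j) else 0) = (\<Sum>j<T'. w (Suc j))"
    by simp
  also have "\<dots> \<le> (\<Sum>j<T. w j)"
    unfolding Suc sum.lessThan_Suc_shift[of w] using assms by simp
  finally show ?thesis .
qed simp

text \<open>The remainder of a product splits into the remainders of the factors and a cross term of
  the two increments, bounded by the arithmetic-geometric mean inequality.\<close>

lemma product_taylor:
  "\<bar>smooth_step a' * ramp b' - smooth_step a * ramp b
     - smooth_step' a * ramp b * (a' - a) - smooth_step a * ramp' b * (b' - b)\<bar>
   \<le> 10 * (a' - a)^2 + 2 * (b' - b)^2"
proof -
  have 1: "\<bar>(smooth_step a' - smooth_step a - smooth_step' a * (a' - a)) * ramp b'\<bar> \<le> 9 * (a' - a)^2 * 1"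
    unfolding abs_mult using smooth_step_taylor[of a' a] ramp_bounds[of b'] by (intro mult_mono) auto
  have 2: "\<bar>smooth_step a * (ramp b' - ramp b - ramp' b * (b' - b))\<bar> \<le> 1 * (b' - b)^2"
    unfolding abs_mult using ramp_taylor[of b' b] smooth_step_bounds[of a] by (intro mult_mono) auto
  have "\<bar>smooth_step' a * (a' - a) * (ramp b' - ramp b)\<bar> \<le> (3/2 * \<bar>a' - a\<bar>) * (1/2 * \<bar>b' - b\<bar>)"
    unfolding abs_mult using ramp_lipschitz[of b' b] smooth_step'_bounds[of a]
    by (intro mult_mono) auto
  also have "\<dots> \<le> (a' - a)^2 + (b' - b)^2"
  proof -
    have "(\<bar>a' - a\<bar> - \<bar>b' - b\<bar>)^2 \<ge> 0" by simp
    then have "2 * (\<bar>a' - a\<bar> * \<bar>b' - b\<bar>) \<le> (a' - a)^2 + (b' - b)^2"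
      by (simp add: power2_diff)
    moreover have "0 \<le> \<bar>a' - a\<bar> * \<bar>b' - b\<bar>" by simp
    ultimately show ?thesis by linarith
  qed
  finally have 3: "\<bar>smooth_step' a * (a' - a) * (ramp b' - ramp b)\<bar> \<le> (a' - a)^2 + (b' - b)^2" .
  have "smooth_step a' * ramp b' - smooth_step a * ramp b
     - smooth_step' a * ramp b * (a' - a) - smooth_step a * ramp' b * (b' - b)
    = (smooth_step a' - smooth_step a - smooth_step' a * (a' - a)) * ramp b'
     + smooth_step a * (ramp b' - ramp b - ramp' b * (b' - b))
     + smooth_step' a * (a' - a) * (ramp b' - ramp b)"
    by (simp add: algebra_simps)
  then show ?thesis using 1 2 3 by linarith
qed

text \<open>An explicit quadratic remainder yields differentiability. A squared increment counts 3
  times at its own coordinate and 10 times as a predecessor, hence 13.\<close>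

lemma chain_taylor:
  "\<bar>chain T y - chain T x - (\<Sum>j<T. chain' T x j * (y j - x j))\<bar> \<le> 13 * (\<Sum>j<T. (y j - x j)^2)"
proof -
  let ?d = "\<lambda>j. y j - x j"
  let ?p = "\<lambda>j. prev y j - prev x j"
  have p: "?p j = (if j = 0 then 0 else ?d (j - 1))" for j by (simp add: prev_def)
  \<comment> \<open>The increments of predecessors are regrouped by the coordinate that moves; index
    0 drops out because \<open>prev\<close> is constant there.\<close>
  have shift: "(\<Sum>j<T. smooth_step' (prev x j) * ramp (x j) * ?p j)
      = (\<Sum>j<T. (if Suc j < T then smooth_step' (x j) * ramp (x (Suc j)) else 0) * ?d j)"
  proof (cases T)
    case (Suc T')
    have "(\<Sum>j<T. smooth_step' (prev x j) * ramp (x j) * ?p j)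
        = (\<Sum>j<T'. smooth_step' (x j) * ramp (x (Suc j)) * ?d j)"
      unfolding Suc sum.lessThan_Suc_shift by (simp add: prev_def)
    then show ?thesis using Suc by simp
  qed simp
  define R where "R j = (penalty (y j) - penalty (x j) - penalty' (x j) * ?d j)
      - (smooth_step (prev y j) * ramp (y j) - smooth_step (prev x j) * ramp (x j)
         - smooth_step' (prev x j) * ramp (x j) * ?p j - smooth_step (prev x j) * ramp' (x j) * ?d j)" for j
  have "chain T y - chain T x - (\<Sum>j<T. chain' T x j * ?d j)
      = (\<Sum>j<T. penalty (y j) - smooth_step (prev y j) * ramp (y j)
            - (penalty (x j) - smooth_step (prev x j) * ramp (x j))
            - (penalty' (x j) - smooth_step (prev x j) * ramp' (x j)) * ?d j)
        + (\<Sum>j<T. (if Suc j < T then smooth_step' (x j) * ramp (x (Suc j)) else 0) * ?d j)"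
    unfolding chain_def sum_subtractf[symmetric] sum.distrib[symmetric]
    by (intro sum.cong refl) (simp add: chain'_def algebra_simps)
  also have "\<dots> = (\<Sum>j<T. R j)"
    unfolding shift[symmetric] sum.distrib[symmetric] R_def
    by (intro sum.cong refl) (simp add: algebra_simps)
  finally have e: "chain T y - chain T x - (\<Sum>j<T. chain' T x j * ?d j) = (\<Sum>j<T. R j)" .
  have R: "\<bar>R j\<bar> \<le> 3 * (?d j)^2 + 10 * (?p j)^2" for j
    using penalty_taylor[of "y j" "x j"]
      product_taylor[of "prev y j" "y j" "prev x j" "x j"] unfolding R_def by linarith
  have "\<bar>\<Sum>j<T. R j\<bar> \<le> (\<Sum>j<T. \<bar>R j\<bar>)" by (rule sum_abs)
  also have "\<dots> \<le> (\<Sum>j<T. 3 * (?d j)^2 + 10 * (?p j)^2)" by (intro sum_mono R)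
  also have "\<dots> = 3 * (\<Sum>j<T. (?d j)^2) + 10 * (\<Sum>j<T. (?p j)^2)"
    by (simp add: sum.distrib sum_distrib_left)
  also have "(\<Sum>j<T. (?p j)^2) = (\<Sum>j<T. if j = 0 then 0 else (?d (j - 1))^2)"
    by (intro sum.cong refl) (simp add: prev_def)
  also have "\<dots> \<le> (\<Sum>j<T. (?d j)^2)" by (rule sum_prev_le) simp
  finally show ?thesis unfolding e by simp
qed

section \<open>Lipschitz bound for the gradient of the chain\<close>

lemma mult_diff_abs_le:
  fixes a b a' b' :: real
  assumes "\<bar>a - a'\<bar> \<le> p" "\<bar>b\<bar> \<le> B" "\<bar>a'\<bar> \<le> A" "\<bar>b - b'\<bar> \<le> q"
  shows "\<bar>a * b - a' * b'\<bar> \<le> p * B + A * q"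
proof -
  have "\<bar>(a - a') * b\<bar> \<le> p * B" "\<bar>a' * (b - b')\<bar> \<le> A * q"
    unfolding abs_mult using assms by (intro mult_mono; linarith)+
  moreover have "a * b - a' * b' = (a - a') * b + a' * (b - b')" by (simp add: algebra_simps)
  ultimately show ?thesis by linarith
qed

text \<open>A partial derivative depends on three neighbouring coordinates, with increment at most 8
  times the sum of theirs. Squaring gives \<open>64 * 3 = 192\<close>, and each coordinate enters at
  most three partial derivatives, so the constant is \<open>192 * 3 = 24^2\<close>.\<close>

lemma chain'_lipschitz:
  "(\<Sum>j<T. (chain' T x j - chain' T y j)^2) \<le> 24^2 * (\<Sum>j<T. (x j - y j)^2)"
proof -
  define p n where "p j = (if j = 0 then 0 else x (j - 1) - y (j - 1))"
    and "n j = (if Suc j < T then x (Suc j) - y (Suc j) else 0)" for j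
  have 1: "\<bar>chain' T x j - chain' T y j\<bar> \<le> 8 * (\<bar>p j\<bar> + \<bar>x j - y j\<bar> + \<bar>n j\<bar>)" if "j < T" for j
  proof -
    have pp: "prev x j - prev y j = p j" by (simp add: prev_def p_def)
    have a: "\<bar>smooth_step (prev x j) * ramp' (x j) - smooth_step (prev y j) * ramp' (y j)\<bar>
        \<le> 3/2 * \<bar>p j\<bar> * (1/2) + 1 * (2/3 * \<bar>x j - y j\<bar>)"
      using smooth_step_lipschitz[of "prev x j" "prev y j"] ramp_bounds[of "x j"]
        smooth_step_bounds[of "prev y j"] ramp'_lipschitz[of "x j" "y j"]
      by (intro mult_diff_abs_le) (auto simp: pp)
    have b: "\<bar>(if Suc j < T then smooth_step' (x j) * ramp (x (Suc j)) else 0)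
         - (if Suc j < T then smooth_step' (y j) * ramp (y (Suc j)) else 0)\<bar>
        \<le> 6 * \<bar>x j - y j\<bar> * 1 + 3/2 * (1/2 * \<bar>n j\<bar>)"
    proof (cases "Suc j < T")
      case True
      have "\<bar>smooth_step' (x j) * ramp (x (Suc j)) - smooth_step' (y j) * ramp (y (Suc j))\<bar>
        \<le> 6 * \<bar>x j - y j\<bar> * 1 + 3/2 * (1/2 * \<bar>x (Suc j) - y (Suc j)\<bar>)"
        using smooth_step'_lipschitz[of "x j" "y j"] ramp_bounds[of "x (Suc j)"]
          smooth_step'_bounds[of "y j"] ramp_lipschitz[of "x (Suc j)" "y (Suc j)"]
        by (intro mult_diff_abs_le) auto
      then show ?thesis using True by (simp add: n_def)
    qed simp
    have c: "\<bar>penalty' (x j) - penalty' (y j)\<bar> \<le> \<bar>x j - y j\<bar>" by (rule penalty'_lipschitz)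
    have "\<bar>r - s - u - (r' - s' - u')\<bar> \<le> \<bar>r - r'\<bar> + \<bar>s - s'\<bar> + \<bar>u - u'\<bar>"
      for r s u r' s' u' :: real by linarith
    note tri = order_trans[OF this add_mono[OF add_mono[OF c a] b]]
    have lin: "e + (3/2 * q * (1/2) + 1 * (2/3 * e)) + (6 * e * 1 + 3/2 * (1/2 * r)) \<le> 8 * (q + e + r)"
      if "0 \<le> q" "0 \<le> e" "0 \<le> r" for q e r :: real using that by simp
    show ?thesis unfolding chain'_def if_P[OF that]
      by (rule order_trans[OF tri lin[OF abs_ge_zero abs_ge_zero abs_ge_zero]])
  qed
  have 2: "(chain' T x j - chain' T y j)^2 \<le> 192 * ((p j)^2 + (x j - y j)^2 + (n j)^2)" if "j < T" for j
  proof -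
    have "(chain' T x j - chain' T y j)^2 \<le> (8 * (\<bar>p j\<bar> + \<bar>x j - y j\<bar> + \<bar>n j\<bar>))^2"
      using 1[OF that] by (subst abs_le_square_iff[symmetric]) simp
    also have "\<dots> = 64 * (\<bar>p j\<bar> + \<bar>x j - y j\<bar> + \<bar>n j\<bar>)^2" by (subst power_mult_distrib) simp
    also have "\<dots> \<le> 64 * (3 * (\<bar>p j\<bar>^2 + \<bar>x j - y j\<bar>^2 + \<bar>n j\<bar>^2))"
    proof -
      have "3 * (a^2 + b^2 + c^2) - (a + b + c)^2 = (a - b)^2 + (b - c)^2 + (a - c)^2" for a b c :: real
        by (simp add: power2_eq_square algebra_simps)
      then have *: "(a + b + c)^2 \<le> 3 * (a^2 + b^2 + c^2)" for a b c :: real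
        by (metis add_nonneg_nonneg diff_ge_0_iff_ge zero_le_power2)
      show ?thesis by (intro mult_left_mono *) simp
    qed
    finally show ?thesis by simp
  qed
  have "(\<Sum>j<T. (chain' T x j - chain' T y j)^2)
      \<le> (\<Sum>j<T. 192 * ((p j)^2 + (x j - y j)^2 + (n j)^2))"
    by (intro sum_mono 2) auto
  also have "\<dots> = 192 * ((\<Sum>j<T. (p j)^2) + (\<Sum>j<T. (x j - y j)^2) + (\<Sum>j<T. (n j)^2))"
    by (simp add: sum.distrib sum_distrib_left algebra_simps)
  also have "(\<Sum>j<T. (p j)^2) = (\<Sum>j<T. if j = 0 then 0 else (x (j - 1) - y (j - 1))^2)"
    by (intro sum.cong refl) (simp add: p_def)
  also have "\<dots> \<le> (\<Sum>j<T. (x j - y j)^2)" by (rule sum_prev_le) simp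
  also have "(\<Sum>j<T. (n j)^2) = (\<Sum>j<T. if Suc j < T then (x (Suc j) - y (Suc j))^2 else 0)"
    by (intro sum.cong refl) (simp add: n_def)
  also have "\<dots> \<le> (\<Sum>j<T. (x j - y j)^2)" by (rule sum_next_le) simp
  finally show ?thesis by simp
qed

section \<open>Size and support of the gradient\<close>

lemma chain'_bounded: "\<bar>chain' T x j\<bar> \<le> 3"
proof -
  have a: "0 \<le> smooth_step (prev x j) * ramp' (x j)" "smooth_step (prev x j) * ramp' (x j) \<le> 1 * (1/2)"
    using smooth_step_bounds[of "prev x j"] ramp_bounds[of "x j"] by (simp, intro mult_mono) auto
  have b: "0 \<le> smooth_step' (x j) * ramp (x (Suc j))" "smooth_step' (x j) * ramp (x (Suc j)) \<le> 3/2 * 1"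
    using smooth_step'_bounds[of "x j"] ramp_bounds[of "x (Suc j)"] by (simp, intro mult_mono) auto
  show ?thesis using a b penalty'_bounds[of "x j"] by (auto simp: chain'_def)
qed

text \<open>Beyond index \<open>m\<close> both the coordinate and its predecessor are 0, where
  \<open>penalty'\<close>, \<open>smooth_step\<close> and \<open>smooth_step'\<close> vanish. So a
  query reveals at most one new coordinate.\<close>

lemma chain'_eq_0:
  assumes "\<forall>i\<ge>m. x i = 0" "j > m"
  shows "chain' T x j = 0"
  using assms by (auto simp: chain'_def prev_def)

lemma chain'_large:
  assumes "T \<ge> 1" "x (T - 1) = 0"
  shows "(\<Sum>j<T. (chain' T x j)^2) \<ge> (1/4)^2"
proof -
  define j where "j = (LEAST j. x j < 1)"
  have ex: "x (T - 1) < 1" using assms by simp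
  have xj: "x j < 1" unfolding j_def using ex by (rule LeastI)
  have "j \<le> T - 1" unfolding j_def using ex by (rule Least_le)
  then have jT: "j < T" using assms by simp
  have "prev x j \<ge> 1"
  proof (cases "j = 0")
    case False
    then have "j - 1 < j" by simp
    then have "\<not> x (j - 1) < 1" using not_less_Least unfolding j_def by blast
    then show ?thesis using False by (simp add: prev_def)
  qed (simp add: prev_def)
  then have s: "smooth_step (prev x j) = 1" by (rule smooth_step_ge1)
  have b: "0 \<le> (if Suc j < T then smooth_step' (x j) * ramp (x (Suc j)) else 0)"
    using smooth_step'_bounds[of "x j"] ramp_bounds[of "x (Suc j)"] by simp
  have c: "penalty' (x j) - ramp' (x j) \<le> -1/4"
  proof (cases "x j \<le> -1/2")
    case True
    then show ?thesis using penalty'_le[of "x j"] ramp_bounds[of "x j"] by simp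
  next
    case False
    then show ?thesis using ramp'_ge[of "x j"] penalty'_bounds[of "x j"] xj by simp
  qed
  have "chain' T x j \<le> -1/4"
    using jT s b c unfolding chain'_def by (simp split del: if_split)
  then have "(1/4)^2 \<le> (chain' T x j)^2"
    by (subst abs_le_square_iff[symmetric]) simp
  also have "\<dots> \<le> (\<Sum>j<T. (chain' T x j)^2)"
    using jT by (intro member_le_sum) auto
  finally show ?thesis .
qed

text \<open>Every summand is at least -1, and none is positive at the origin. This is how the gap
  \<open>\<Delta>\<close> limits the length of the chain.\<close>

lemma chain_decrease: "chain T zerov - chain T x \<le> real T"
proof -
  have "chain T zerov \<le> 0"
    unfolding chain_def zerov_def using smooth_step_bounds ramp_bounds
    by (intro sum_nonpos) auto
  moreover have "(\<Sum>j<T. (-1::real)) \<le> chain T x"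
    unfolding chain_def
  proof (intro sum_mono)
    fix j
    have "smooth_step (prev x j) * ramp (x j) \<le> 1 * 1"
      using smooth_step_bounds ramp_bounds by (intro mult_mono) auto
    then show "-1 \<le> penalty (x j) - smooth_step (prev x j) * ramp (x j)"
      using penalty_nonneg[of "x j"] by linarith
  qed
  ultimately show ?thesis by simp
qed

text \<open>Dividing the argument by \<open>b\<close> and multiplying the value by
  \<open>a * b\<close> scales the gradient by \<open>a\<close>, its Lipschitz constant by
  \<open>a / b\<close> and the decrease by \<open>a * b\<close>.\<close>

lemma scaled_chain_F_class:
  assumes a: "a > 0" and b: "b > 0" and L: "24 * a = L * b" and \<Delta>: "a * b * real T \<le> \<Delta>"
  shows "F_class T \<Delta> L (\<lambda>x. a * b * chain T (\<lambda>i. x i / b)) (\<lambda>x i. a * chain' T (\<lambda>i. x i / b) i)"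
proof -
  let ?f = "\<lambda>x. a * b * chain T (\<lambda>i. x i / b)"
  let ?g = "\<lambda>x i. a * chain' T (\<lambda>i. x i / b) i"
  have grad: "is_gradient_on T ?f ?g"
    unfolding is_gradient_on_def
  proof (intro ballI conjI allI impI)
    fix x :: vec assume "x \<in> Rd T"
    show "?g x \<in> Rd T" by (simp add: Rd_def chain'_def)
    fix e :: real assume e: "e > 0"
    define C where "C = 13 * a / b"
    have C: "C > 0" using a b by (simp add: C_def)
    show "\<exists>\<delta>>0. \<forall>y\<in>Rd T. normd T (\<lambda>i. y i - x i) < \<delta> \<longrightarrow>
        \<bar>?f y - ?f x - ipd T (?g x) (\<lambda>i. y i - x i)\<bar> \<le> e * normd T (\<lambda>i. y i - x i)"
    proof (intro exI[of _ "e / C"] conjI ballI impI)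
      show "e / C > 0" using e C by simp
      fix y :: vec assume lt: "normd T (\<lambda>i. y i - x i) < e / C"
      let ?N = "normd T (\<lambda>i. y i - x i)"
      have N0: "?N \<ge> 0" by (simp add: normd_def sum_nonneg)
      have N2: "?N^2 = (\<Sum>i<T. (y i - x i)^2)" by (simp add: normd_def sum_nonneg)
      have "?f y - ?f x - ipd T (?g x) (\<lambda>i. y i - x i)
          = a * b * (chain T (\<lambda>i. y i / b) - chain T (\<lambda>i. x i / b)
              - (\<Sum>j<T. chain' T (\<lambda>i. x i / b) j * (y j / b - x j / b)))"
        using b by (simp add: ipd_def algebra_simps sum_distrib_left sum_subtractf)
      then have "\<bar>?f y - ?f x - ipd T (?g x) (\<lambda>i. y i - x i)\<bar>
          \<le> a * b * (13 * (\<Sum>j<T. (y j / b - x j / b)^2))"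
        using a b chain_taylor[of T "\<lambda>i. y i / b" "\<lambda>i. x i / b"] by (simp add: abs_mult)
      also have "(\<Sum>j<T. (y j / b - x j / b)^2) = ?N^2 / b^2"
        unfolding N2 sum_divide_distrib by (simp add: diff_divide_distrib[symmetric] power_divide)
      also have "a * b * (13 * (?N^2 / b^2)) = C * ?N * ?N"
        using b by (simp add: C_def power2_eq_square)
      also have "\<dots> \<le> e * ?N"
        using lt C N0 by (intro mult_right_mono) (simp_all add: field_simps)
      finally show "\<bar>?f y - ?f x - ipd T (?g x) (\<lambda>i. y i - x i)\<bar> \<le> e * ?N" .
    qed
  qed
  have lip: "normd T (\<lambda>i. ?g x i - ?g y i) \<le> L * normd T (\<lambda>i. x i - y i)" for x y
  proof -
    have Lpos: "L > 0" using a b L by (metis mult_pos_pos zero_less_mult_pos2 zero_less_numeral)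
    have "(\<Sum>i<T. (?g x i - ?g y i)^2)
        = a^2 * (\<Sum>i<T. (chain' T (\<lambda>i. x i / b) i - chain' T (\<lambda>i. y i / b) i)^2)"
      unfolding sum_distrib_left by (simp add: right_diff_distrib[symmetric] power_mult_distrib)
    also have "\<dots> \<le> a^2 * (24^2 * (\<Sum>i<T. (x i / b - y i / b)^2))"
      by (intro mult_left_mono chain'_lipschitz) simp
    also have "(\<Sum>j<T. (x j / b - y j / b)^2) = (\<Sum>i<T. (x i - y i)^2) / b^2"
      unfolding sum_divide_distrib by (simp add: diff_divide_distrib[symmetric] power_divide)
    also have "a^2 * (24^2 * ((\<Sum>i<T. (x i - y i)^2) / b^2)) = (24 * a / b)^2 * (\<Sum>i<T. (x i - y i)^2)"
      by (simp add: power_mult_distrib power_divide)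
    also have "24 * a / b = L" using L b by simp
    finally have "sqrt (\<Sum>i<T. (?g x i - ?g y i)^2) \<le> sqrt (L^2 * (\<Sum>i<T. (x i - y i)^2))"
      by (rule real_sqrt_le_mono)
    then show ?thesis using Lpos by (simp add: normd_def real_sqrt_mult)
  qed
  have "?f zerov - ?f x \<le> \<Delta>" for x
  proof -
    have "?f zerov - ?f x = a * b * (chain T zerov - chain T (\<lambda>i. x i / b))"
      by (simp add: zerov_def right_diff_distrib)
    also have "\<dots> \<le> a * b * real T"
      using a b by (intro mult_left_mono chain_decrease) auto
    finally show ?thesis using \<Delta> by simp
  qed
  then show ?thesis using grad lip by (simp add: F_class_def)
qed

section \<open>The noise\<close>

text \<open>Gluing the first \<open>i\<close> entries of one sample to a second, independent sample
  preserves the product measure. After gluing, \<open>C\<close> is read off the first sample and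
  entry \<open>i\<close> off the second, so the event is a rectangle.\<close>

lemma (in sequence_space) emeasure_past_Int_present:
  assumes C: "C \<in> sets S" and D: "D \<in> sets M"
    and past: "\<And>\<omega> \<omega>'. \<omega> \<in> space S \<Longrightarrow> \<omega>' \<in> space S \<Longrightarrow> (\<And>j. j < i \<Longrightarrow> \<omega> j = \<omega>' j) \<Longrightarrow> \<omega> \<in> C \<Longrightarrow> \<omega>' \<in> C"
  shows "emeasure S (C \<inter> {\<omega>\<in>space S. \<omega> i \<in> D}) = emeasure S C * emeasure M D"
proof -
  let ?f = "\<lambda>(\<omega>, \<omega>'). comb_seq i \<omega> \<omega>'"
  let ?X = "C \<inter> {\<omega>\<in>space S. \<omega> i \<in> D}"
  have D': "{\<omega>\<in>space S. \<omega> j \<in> D} \<in> sets S" for j using D by measurable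
  have comb: "comb_seq i \<omega> \<omega>' \<in> space S" if "\<omega> \<in> space S" "\<omega>' \<in> space S" for \<omega> \<omega>'
    using that by (auto simp: space_PiM PiE_iff split: split_comb_seq)
  have C_iff: "comb_seq i \<omega> \<omega>' \<in> C \<longleftrightarrow> \<omega> \<in> C" if "\<omega> \<in> space S" "\<omega>' \<in> space S" for \<omega> \<omega>'
    using past[OF that(1) comb[OF that]] past[OF comb[OF that] that(1)] by (auto simp: comb_seq_less)
  have "?f -` ?X \<inter> space (S \<Otimes>\<^sub>M S) = C \<times> {\<omega>\<in>space S. \<omega> 0 \<in> D}"
    using C_iff comb sets.sets_into_space[OF C]
    by (auto simp: space_pair_measure comb_seq_def)
  moreover have "emeasure S ?X = emeasure (distr (S \<Otimes>\<^sub>M S) S ?f) ?X"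
    by (simp only: PiM_comb_seq)
  moreover have "\<dots> = emeasure (S \<Otimes>\<^sub>M S) (?f -` ?X \<inter> space (S \<Otimes>\<^sub>M S))"
    using C D' by (intro emeasure_distr measurable_comb_seq) auto
  ultimately have "emeasure S ?X = emeasure S C * emeasure S {\<omega>\<in>space S. \<omega> 0 \<in> D}"
    using C D' by (simp add: P.emeasure_pair_measure_Times)
  also have "emeasure S {\<omega>\<in>space S. \<omega> 0 \<in> D} = emeasure M D"
    using emeasure_PiM_Collect_single[of 0 D] D by simp
  finally show ?thesis .
qed

text \<open>Algorithms need not be measurable; events about a finite history are measurable nevertheless,
  because a finite noise space leaves only finitely many histories.\<close>
lemma noise_event_measurable:
  fixes Q :: "(nat \<times> nat) set"
  assumes D0: "finite (space D0)" "sets D0 = Pow (space D0)" and Q: "finite Q"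
    and dep: "\<And>\<omega> \<omega>'. \<omega> \<in> space (noise_space D0) \<Longrightarrow> \<omega>' \<in> space (noise_space D0) \<Longrightarrow>
      (\<And>j i. (j, i) \<in> Q \<Longrightarrow> \<omega> j i = \<omega>' j i) \<Longrightarrow> P \<omega> \<Longrightarrow> P \<omega>'"
  shows "{\<omega> \<in> space (noise_space D0). P \<omega>} \<in> sets (noise_space D0)"
proof -
  let ?N = "noise_space D0"
  \<comment> \<open>\<open>pat\<close> records the outcomes at the positions in \<open>Q\<close>. By
    \<open>dep\<close> the event is a union of fibres of \<open>pat\<close>, and there are only
    finitely many patterns.\<close>
  define pat where "pat \<omega> = restrict (\<lambda>(j, i). \<omega> j i) Q" for \<omega> :: "nat \<Rightarrow> nat \<Rightarrow> real"
  have sp: "\<omega> j i \<in> space D0" if "\<omega> \<in> space ?N" for \<omega> j i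
    using that by (auto simp: noise_space_def space_PiM PiE_iff)
  have pat_in: "pat \<omega> \<in> Q \<rightarrow>\<^sub>E space D0" if "\<omega> \<in> space ?N" for \<omega>
    using sp[OF that] by (auto simp: pat_def)
  have fin: "finite (pat ` {\<omega> \<in> space ?N. P \<omega>})"
    by (rule finite_subset[OF _ finite_PiE[OF Q, of "\<lambda>_. space D0"]]) (use pat_in D0 in auto)
  have eq: "{\<omega> \<in> space ?N. P \<omega>}
      = (\<Union>v\<in>pat ` {\<omega> \<in> space ?N. P \<omega>}. {\<omega> \<in> space ?N. \<forall>q\<in>Q. \<omega> (fst q) (snd q) \<in> {v q}})" (is "?L = ?R")
  proof (intro subset_antisym subsetI)
    fix \<omega> assume "\<omega> \<in> ?L" then show "\<omega> \<in> ?R" by (auto simp: pat_def)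
  next
    fix \<omega> assume "\<omega> \<in> ?R"
    then obtain \<omega>' where "\<omega> \<in> space ?N" "\<omega>' \<in> space ?N" "P \<omega>'"
      "\<forall>q\<in>Q. \<omega> (fst q) (snd q) = pat \<omega>' q" by auto
    then show "\<omega> \<in> ?L" using dep[of \<omega>' \<omega>] by (fastforce simp: pat_def)
  qed
  have "{\<omega> \<in> space ?N. \<forall>q\<in>Q. \<omega> (fst q) (snd q) \<in> {pat \<omega>' q}} \<in> sets ?N" if "\<omega>' \<in> space ?N" for \<omega>'
  proof (intro sets.sets_Collect_finite_All Q)
    fix q assume "q \<in> Q"
    then have "{pat \<omega>' q} \<in> sets D0" using pat_in[OF that] D0 by (auto simp: PiE_iff)
    moreover have "(\<lambda>\<omega>. \<omega> (fst q) (snd q)) \<in> measurable ?N D0"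
      unfolding noise_space_def
      by (rule measurable_compose[where f = "\<lambda>\<omega>. \<omega> (fst q)" and g = "\<lambda>\<xi>. \<xi> (snd q)"];
          rule measurable_component_singleton; simp)
    ultimately have "(\<lambda>\<omega>. \<omega> (fst q) (snd q)) -` {pat \<omega>' q} \<inter> space ?N \<in> sets ?N"
      by (rule measurable_sets[rotated])
    then show "{\<omega> \<in> space ?N. \<omega> (fst q) (snd q) \<in> {pat \<omega>' q}} \<in> sets ?N"
      by (simp add: vimage_def Int_def conj_commute)
  qed
  then show ?thesis by (subst eq) (intro sets.finite_UN fin, auto)
qed

section \<open>Biased coins\<close>

definition bernoulli_measure :: "real \<Rightarrow> real measure" where
  "bernoulli_measure p = point_measure {0, 1} (\<lambda>x. ennreal (if x = 1 then p else 1 - p))"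

lemma space_bernoulli [simp]: "space (bernoulli_measure p) = {0, 1}"
  and sets_bernoulli [simp]: "sets (bernoulli_measure p) = Pow {0, 1}"
  by (simp_all add: bernoulli_measure_def space_point_measure sets_point_measure)

lemma emeasure_bernoulli_1: "emeasure (bernoulli_measure p) {1} = ennreal p"
  by (simp add: bernoulli_measure_def emeasure_point_measure_finite)

lemma prob_space_bernoulli:
  assumes "0 \<le> p" "p \<le> 1" shows "prob_space (bernoulli_measure p)"
proof
  show "emeasure (bernoulli_measure p) (space (bernoulli_measure p)) = 1"
    using assms by (simp add: bernoulli_measure_def space_point_measure emeasure_point_measure_finite
        ennreal_plus[symmetric] del: ennreal_plus)
qed

lemma integral_bernoulli:
  assumes "0 \<le> p" "p \<le> 1"
  shows "integrable (bernoulli_measure p) (h :: real \<Rightarrow> real)"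
    and "(\<integral>x. h x \<partial>bernoulli_measure p) = (1 - p) * h 0 + p * h 1"
proof -
  show "integrable (bernoulli_measure p) h"
    unfolding bernoulli_measure_def by (rule integrable_point_measure_finite) simp
  show "(\<integral>x. h x \<partial>bernoulli_measure p) = (1 - p) * h 0 + p * h 1"
    unfolding bernoulli_measure_def
    by (subst lebesgue_integral_point_measure_finite) (use assms in auto)
qed

text \<open>The union bound over the coins in \<open>I\<close>, combined with the trivial bound
  1.\<close>

lemma emeasure_bernoulli_some_1:
  assumes p: "0 \<le> p" "p \<le> 1" and I: "finite I"
  defines "M \<equiv> PiM (UNIV :: nat set) (\<lambda>_. bernoulli_measure p)"
  shows "{\<xi> \<in> space M. \<exists>i\<in>I. \<xi> i = 1} \<in> sets M"
    and "emeasure M {\<xi> \<in> space M. \<exists>i\<in>I. \<xi> i = 1} \<le> ennreal (min 1 (real (card I) * p))"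
proof -
  interpret coin: product_prob_space "\<lambda>_::nat. bernoulli_measure p" UNIV
    by (rule product_prob_spaceI) (rule prob_space_bernoulli[OF p])
  interpret tosses: prob_space M unfolding M_def by (rule prob_space_PiM) (rule prob_space_bernoulli[OF p])
  have m: "{\<xi> \<in> space M. \<xi> i \<in> {1}} \<in> sets M" for i
    unfolding M_def by (rule sets_Collect_single) auto
  then have m': "{\<xi> \<in> space M. \<xi> i = 1} \<in> sets M" for i by simp
  show "{\<xi> \<in> space M. \<exists>i\<in>I. \<xi> i = 1} \<in> sets M"
    using I m' by (intro sets.sets_Collect_finite_Ex) auto
  have e: "emeasure M {\<xi> \<in> space M. \<xi> i \<in> {1}} = ennreal p" for i
    unfolding M_def by (subst coin.emeasure_PiM_Collect_single) (auto simp: emeasure_bernoulli_1)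
  have "{\<xi> \<in> space M. \<exists>i\<in>I. \<xi> i = 1} = (\<Union>i\<in>I. {\<xi> \<in> space M. \<xi> i \<in> {1}})" by auto
  then have "emeasure M {\<xi> \<in> space M. \<exists>i\<in>I. \<xi> i = 1} \<le> (\<Sum>i\<in>I. emeasure M {\<xi> \<in> space M. \<xi> i \<in> {1}})"
    using I m by (auto intro!: emeasure_subadditive_finite)
  also have "\<dots> = ennreal (real (card I) * p)"
    using p by (simp add: e[simplified] ennreal_of_nat_eq_real_of_nat ennreal_mult)
  finally show "emeasure M {\<xi> \<in> space M. \<exists>i\<in>I. \<xi> i = 1} \<le> ennreal (min 1 (real (card I) * p))"
    using tosses.emeasure_le_1[of "{\<xi> \<in> space M. \<exists>i\<in>I. \<xi> i = 1}"] by (simp add: min_def)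
qed

section \<open>Discovering coordinates\<close>

text \<open>The counting argument rests on how answers enlarge supports: coin value 0 keeps a
  prefix, value 1 extends it by at most one coordinate.\<close>

locale sync_protocol =
  fixes d n :: nat and \<tau> :: "nat \<Rightarrow> real" and A :: alg and G :: "vec \<Rightarrow> real \<Rightarrow> vec"
  assumes algorithm: "is_algorithm d A"
    and zero_resp: "zero_respecting d A"
    and \<tau>_nonneg: "\<And>i. i \<in> {1..n} \<Longrightarrow> 0 \<le> \<tau> i"
    and G_dim: "\<And>x \<xi>. x \<in> Rd d \<Longrightarrow> \<xi> \<in> {0, 1} \<Longrightarrow> G x \<xi> \<in> Rd d"
    and G_0: "\<And>x m. x \<in> Rd m \<Longrightarrow> G x 0 \<in> Rd m"
    and G_1: "\<And>x m. x \<in> Rd m \<Longrightarrow> G x 1 \<in> Rd (Suc m)"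
begin

definition replies :: "(nat \<Rightarrow> nat \<Rightarrow> real) \<Rightarrow> nat \<Rightarrow> vec list" where
  "replies \<omega> k = fst (run A G n \<tau> \<omega> k)"

definition start_time :: "(nat \<Rightarrow> nat \<Rightarrow> real) \<Rightarrow> nat \<Rightarrow> real" where
  "start_time \<omega> k = fst (snd (run A G n \<tau> \<omega> k))"

definition start_point :: "(nat \<Rightarrow> nat \<Rightarrow> real) \<Rightarrow> nat \<Rightarrow> vec" where
  "start_point \<omega> k = fst (snd (snd (run A G n \<tau> \<omega> k)))"

definition busy :: "(nat \<Rightarrow> nat \<Rightarrow> real) \<Rightarrow> nat \<Rightarrow> bool" where
  "busy \<omega> k = snd (snd (snd (run A G n \<tau> \<omega> k)))"

abbreviation "time \<equiv> iterate_t A G n \<tau>"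
abbreviation "iter \<equiv> iterate_x A G n \<tau>"

text \<open>Query \<open>k\<close> carries the time \<open>time \<omega> (Suc k)\<close>, since an
  algorithm returns \<open>x^k\<close> together with the next time. An idle step only stores the
  query, so nobody answers.\<close>

definition answering :: "(nat \<Rightarrow> nat \<Rightarrow> real) \<Rightarrow> nat \<Rightarrow> nat set" where
  "answering \<omega> k = (if busy \<omega> k then {i \<in> {1..n}. start_time \<omega> k + \<tau> i \<le> time \<omega> (Suc k)} else {})"

definition hit :: "(nat \<Rightarrow> nat \<Rightarrow> real) \<Rightarrow> nat \<Rightarrow> bool" where
  "hit \<omega> k \<longleftrightarrow> (\<exists>i\<in>answering \<omega> k. \<omega> (Suc k) i = 1)"

text \<open>The maximal index bounds the size of \<open>I\<close>, so \<open>cost I\<close> pays for \<open>card I\<close> coins whatever the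
  order of the \<open>\<tau> i\<close>.\<close>
definition cost :: "nat set \<Rightarrow> real" where
  "cost I = (if I = {} then 0 else \<tau> (Max I))"

section \<open>States of a run\<close>

lemma run_eq: "run A G n \<tau> \<omega> k = (replies \<omega> k, start_time \<omega> k, start_point \<omega> k, busy \<omega> k)"
  by (simp add: replies_def start_time_def start_point_def busy_def)

lemma iter_eq: "iter \<omega> k = snd (A (replies \<omega> k))" and time_Suc: "time \<omega> (Suc k) = fst (A (replies \<omega> k))"
  by (simp_all add: iterate_x_def iterate_t_def replies_def)

lemma run_0: "replies \<omega> 0 = []" "start_time \<omega> 0 = 0" "start_point \<omega> 0 = zerov" "\<not> busy \<omega> 0"
  by (simp_all add: replies_def start_time_def start_point_def busy_def)

lemma run_idle:
  assumes "\<not> busy \<omega> k"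
  shows "replies \<omega> (Suc k) = replies \<omega> k @ [zerov]" "start_time \<omega> (Suc k) = time \<omega> (Suc k)"
    "start_point \<omega> (Suc k) = iter \<omega> k" "busy \<omega> (Suc k)"
  using assms run_eq[of \<omega> k] run_eq[of \<omega> "Suc k"]
  by (auto simp: sync_oracle_def Let_def iter_eq time_Suc split: prod.splits)

lemma run_busy:
  assumes "busy \<omega> k"
  shows "replies \<omega> (Suc k) = replies \<omega> k @ [\<lambda>j. \<Sum>i\<in>answering \<omega> k. G (start_point \<omega> k) (\<omega> (Suc k) i) j]"
    "start_time \<omega> (Suc k) = 0" "start_point \<omega> (Suc k) = zerov" "\<not> busy \<omega> (Suc k)"
  using assms run_eq[of \<omega> k] run_eq[of \<omega> "Suc k"]
  by (auto simp: sync_oracle_def Let_def answering_def time_Suc split: prod.splits)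

lemma run_cong:
  assumes "\<And>j i. j \<in> {1..k} \<Longrightarrow> i \<in> {1..n} \<Longrightarrow> \<omega> j i = \<omega>' j i"
  shows "run A G n \<tau> \<omega> k = run A G n \<tau> \<omega>' k"
  using assms
proof (induction k)
  case (Suc k)
  then have IH: "run A G n \<tau> \<omega> k = run A G n \<tau> \<omega>' k" by simp
  have "sync_oracle G n \<tau> t x s (\<omega> (Suc k)) = sync_oracle G n \<tau> t x s (\<omega>' (Suc k))" for t x s
    using Suc.prems by (auto simp: sync_oracle_def intro!: ext sum.cong split: prod.split)
  then show ?case by (simp add: IH)
qed simp

lemma answering_subset: "answering \<omega> k \<subseteq> {1..n}" "finite (answering \<omega> k)"
  by (auto simp: answering_def)

lemma cost_nonneg:
  assumes I: "I \<subseteq> {1..n}" shows "0 \<le> cost I"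
proof (cases "I = {}")
  case False
  have "finite I" using I by (rule finite_subset) simp
  then have "Max I \<in> {1..n}" using Max_in[OF _ False] I by blast
  then show ?thesis using \<tau>_nonneg False by (simp add: cost_def)
qed (simp add: cost_def)

text \<open>All workers in one answer evaluate at the same stored point, so several successful coins
  together still extend the prefix by only one coordinate. Zero-respecting queries then stay in the
  prefix of the replies.\<close>

lemma supported_below:
  assumes bits: "\<forall>k i. \<omega> k i \<in> {0, 1}"
  shows "set (replies \<omega> k) \<subseteq> Rd d \<inter> Rd (card {j. j < k \<and> hit \<omega> j}) \<and>
         start_point \<omega> k \<in> Rd d \<inter> Rd (card {j. j < k \<and> hit \<omega> j}) \<and>
         iter \<omega> k \<in> Rd d \<inter> Rd (card {j. j < k \<and> hit \<omega> j})"
proof (induction k)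
  have iter_in: "iter \<omega> k \<in> Rd d \<inter> Rd m" if r: "set (replies \<omega> k) \<subseteq> Rd d \<inter> Rd m" for k m
  proof -
    have "iter \<omega> k \<in> Rd d" using algorithm r by (auto simp: is_algorithm_def iter_eq)
    moreover have "supp (iter \<omega> k) \<subseteq> (\<Union>g\<in>set (replies \<omega> k). supp g)"
      using zero_resp r by (auto simp: zero_respecting_def iter_eq)
    then have "iter \<omega> k \<in> Rd m" using r by (force simp: supp_def Rd_def)
    ultimately show ?thesis by simp
  qed
  {
    case 0
    show ?case using iter_in[of 0 0] by (auto simp: run_0 Rd_def zerov_def)
  next
    case (Suc k)
    let ?m = "card {j. j < k \<and> hit \<omega> j}" and ?m' = "card {j. j < Suc k \<and> hit \<omega> j}"
    have "{j. j < Suc k \<and> hit \<omega> j} = (if hit \<omega> k then insert k {j. j < k \<and> hit \<omega> j} else {j. j < k \<and> hit \<omega> j})"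
      by (auto simp: less_Suc_eq)
    then have m': "?m' = (if hit \<omega> k then Suc ?m else ?m)" by simp
    have mono: "Rd ?m \<subseteq> Rd ?m'" by (auto simp: Rd_def m')
    have "set (replies \<omega> (Suc k)) \<subseteq> Rd d \<inter> Rd ?m' \<and> start_point \<omega> (Suc k) \<in> Rd d \<inter> Rd ?m'"
    proof (cases "busy \<omega> k")
      case False
      have "zerov \<in> Rd d \<inter> Rd ?m'" by (simp add: Rd_def zerov_def)
      then show ?thesis using Suc mono by (auto simp: run_idle[OF False])
    next
      case True
      have 0: "zerov \<in> Rd d \<inter> Rd ?m'" by (simp add: Rd_def zerov_def)
      have "G (start_point \<omega> k) (\<omega> (Suc k) i) \<in> Rd d \<inter> Rd ?m'" if i: "i \<in> answering \<omega> k" for i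
      proof -
        have "G (start_point \<omega> k) (\<omega> (Suc k) i) \<in> Rd d" using Suc bits by (intro G_dim) auto
        moreover have "G (start_point \<omega> k) (\<omega> (Suc k) i) \<in> Rd ?m'"
        proof (cases "\<omega> (Suc k) i = 1")
          case True
          then have "hit \<omega> k" using i by (auto simp: hit_def)
          then show ?thesis using Suc True G_1 m' by auto
        next
          case False
          then have "\<omega> (Suc k) i = 0" using bits by auto
          then show ?thesis using Suc G_0[of "start_point \<omega> k" ?m] mono by auto
        qed
        ultimately show ?thesis by simp
      qed
      then have "(\<lambda>j. \<Sum>i\<in>answering \<omega> k. G (start_point \<omega> k) (\<omega> (Suc k) i) j) \<in> Rd d \<inter> Rd ?m'"
        by (auto simp: Rd_def intro!: sum.neutral)
      then show ?thesis using Suc mono 0 by (auto simp: run_busy[OF True])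
    qed
    then show ?case using iter_in by blast
  }
qed

lemma time_mono_Suc:
  assumes bits: "\<forall>k i. \<omega> k i \<in> {0, 1}"
  shows "0 \<le> time \<omega> k" "time \<omega> k \<le> time \<omega> (Suc k)"
proof -
  have r: "set (replies \<omega> k) \<subseteq> Rd d" for k using supported_below[OF bits] by blast
  have nn: "0 \<le> time \<omega> k" for k
    using algorithm r by (cases k) (auto simp: is_algorithm_def time_Suc, simp add: iterate_t_def)
  show "0 \<le> time \<omega> k" by (rule nn)
  show "time \<omega> k \<le> time \<omega> (Suc k)"
  proof (cases k)
    case 0
    then show ?thesis using nn[of 1] by (simp add: iterate_t_def)
  next
    case (Suc j)
    obtain g where g: "replies \<omega> k = replies \<omega> j @ [g]"
      using run_idle(1)[of \<omega> j] run_busy(1)[of \<omega> j] Suc by (cases "busy \<omega> j") auto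
    then show ?thesis using algorithm r[of k] unfolding Suc time_Suc
      by (auto simp: is_algorithm_def Suc)
  qed
qed

lemma time_mono:
  assumes "\<forall>k i. \<omega> k i \<in> {0, 1}" "j \<le> k"
  shows "time \<omega> j \<le> time \<omega> k"
  using assms(2) by (rule lift_Suc_mono_le[of "time \<omega>", rotated]) (rule time_mono_Suc[OF assms(1)])

text \<open>An answer involving the workers in \<open>I\<close> takes at least the time \<open>cost I\<close>, and answers do not
  overlap in time.\<close>
lemma total_cost_le:
  assumes bits: "\<forall>k i. \<omega> k i \<in> {0, 1}"
  shows "(\<Sum>j<k. cost (answering \<omega> j)) \<le> (if busy \<omega> k then start_time \<omega> k else time \<omega> k) \<and>
    (busy \<omega> k \<longrightarrow> start_time \<omega> k \<le> time \<omega> k)"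
\<comment> \<open>While a query is pending, only the time before its start has been charged; the
  second conjunct settles an answer without finished workers, which costs 0.\<close>
proof (induction k)
  case 0
  show ?case by (simp add: run_0 iterate_t_def)
next
  case (Suc k)
  note mono = time_mono_Suc(2)[OF bits, of k]
  show ?case
  proof (cases "busy \<omega> k")
    case False
    then have "answering \<omega> k = {}" by (simp add: answering_def)
    then show ?thesis using Suc False mono by (simp add: run_idle[OF False] cost_def)
  next
    case True
    have "start_time \<omega> k + cost (answering \<omega> k) \<le> time \<omega> (Suc k)"
    proof (cases "answering \<omega> k = {}")
      case False
      then have "Max (answering \<omega> k) \<in> answering \<omega> k" by (intro Max_in answering_subset)
      moreover have "start_time \<omega> k + \<tau> i \<le> time \<omega> (Suc k)" if "i \<in> answering \<omega> k" for i
        using that True by (simp add: answering_def)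
      ultimately show ?thesis using False by (simp add: cost_def)
    qed (use Suc True mono in \<open>simp add: cost_def\<close>)
    then show ?thesis using Suc True by (simp add: run_busy[OF True])
  qed
qed

text \<open>Times are monotone, so the counted answers form an initial segment, whose total cost is
  at most the time of the last one.\<close>

lemma total_cost_before_le:
  assumes bits: "\<forall>k i. \<omega> k i \<in> {0, 1}" and t: "0 \<le> t"
  shows "(\<Sum>j<k. if time \<omega> (Suc j) \<le> t then cost (answering \<omega> j) else 0) \<le> t"
proof (induction k)
  case (Suc k)
  show ?case
  proof (cases "time \<omega> (Suc k) \<le> t")
    case True
    have "(\<Sum>j<Suc k. if time \<omega> (Suc j) \<le> t then cost (answering \<omega> j) else 0)
        = (\<Sum>j<Suc k. cost (answering \<omega> j))"
    proof (intro sum.cong refl)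
      fix j assume "j \<in> {..<Suc k}"
      then have "time \<omega> (Suc j) \<le> time \<omega> (Suc k)" by (intro time_mono[OF bits]) auto
      then show "(if time \<omega> (Suc j) \<le> t then cost (answering \<omega> j) else 0) = cost (answering \<omega> j)"
        using True by simp
    qed
    also have "\<dots> \<le> time \<omega> (Suc k)"
      using total_cost_le[OF bits, of "Suc k"] by (auto split: if_splits)
    finally show ?thesis using True by simp
  qed (use Suc in simp)
qed (use t in simp)

subsection \<open>Expected number of hits\<close>

text \<open>The first \<open>k\<close> steps read only the finitely many coins in
  \<open>{1..k} \<times> {1..n}\<close>.\<close>

lemma past_event_measurable:
  assumes "\<And>\<omega> \<omega>'. run A G n \<tau> \<omega> k = run A G n \<tau> \<omega>' k \<Longrightarrow> P \<omega> \<Longrightarrow> P \<omega>'"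
  shows "{\<omega> \<in> space (noise_space (bernoulli_measure p)). P \<omega>} \<in> sets (noise_space (bernoulli_measure p))"
proof (rule noise_event_measurable[where Q = "{1..k} \<times> {1..n}"])
  fix \<omega> \<omega>' :: "nat \<Rightarrow> nat \<Rightarrow> real"
  assume "\<And>j i. (j, i) \<in> {1..k} \<times> {1..n} \<Longrightarrow> \<omega> j i = \<omega>' j i" and P: "P \<omega>"
  then have "run A G n \<tau> \<omega> k = run A G n \<tau> \<omega>' k" by (intro run_cong) simp
  then show "P \<omega>'" using P by (rule assms)
qed simp_all

lemma answering_cong:
  assumes "run A G n \<tau> \<omega> k = run A G n \<tau> \<omega>' k"
  shows "answering \<omega> k = answering \<omega>' k" "time \<omega> (Suc k) = time \<omega>' (Suc k)"
  using assms by (simp_all add: answering_def busy_def start_time_def iterate_t_def)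

text \<open>The set of answering workers is fixed by the past, and the coins of the answer are
  fresh. For each of its finitely many values \<open>I\<close>, the conditional chance of a hit is
  at most \<open>min 1 (real (card I) * p)\<close>, hence at most
  \<open>\<rho> * cost I\<close>.\<close>

lemma emeasure_hit_le:
  fixes p \<rho> t :: real
  assumes p: "0 \<le> p" "p \<le> 1" and \<rho>: "0 \<le> \<rho>" "\<And>m. m \<in> {1..n} \<Longrightarrow> min 1 (real m * p) \<le> \<rho> * \<tau> m"
  defines "N \<equiv> noise_space (bernoulli_measure p)"
  shows "{\<omega> \<in> space N. hit \<omega> k \<and> time \<omega> (Suc k) \<le> t} \<in> sets N"
    and "emeasure N {\<omega> \<in> space N. hit \<omega> k \<and> time \<omega> (Suc k) \<le> t}
      \<le> (\<integral>\<^sup>+\<omega>. ennreal (\<rho> * (if time \<omega> (Suc k) \<le> t then cost (answering \<omega> k) else 0)) \<partial>N)"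
    and "(\<lambda>\<omega>. ennreal (\<rho> * (if time \<omega> (Suc k) \<le> t then cost (answering \<omega> k) else 0))) \<in> borel_measurable N"
proof -
  let ?M = "PiM (UNIV :: nat set) (\<lambda>_. bernoulli_measure p)"
  have pM: "prob_space ?M" by (rule prob_space_PiM) (rule prob_space_bernoulli[OF p])
  interpret sequence_space ?M
    by (intro sequence_space.intro product_prob_spaceI pM)
  have NS: "N = PiM UNIV (\<lambda>_. ?M)" by (simp add: N_def noise_space_def)
  define C where "C I = {\<omega> \<in> space N. answering \<omega> k = I \<and> time \<omega> (Suc k) \<le> t}" for I
  define D where "D I = {\<xi> \<in> space ?M. \<exists>i\<in>I. \<xi> i = 1}" for I
  have C: "C I \<in> sets N" for I
    unfolding C_def N_def by (rule past_event_measurable[of k]) (metis answering_cong)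
  have D: "D I \<in> sets ?M" "emeasure ?M (D I) \<le> ennreal (\<rho> * cost I)" if I: "I \<in> Pow {1..n}" for I
  proof -
    have fin: "finite I" using I by (auto intro: finite_subset)
    show "D I \<in> sets ?M" unfolding D_def by (rule emeasure_bernoulli_some_1[OF p fin])
    show "emeasure ?M (D I) \<le> ennreal (\<rho> * cost I)"
    proof (cases "I = {}")
      case False
      then have M: "Max I \<in> I" "Max I \<in> {1..n}" using Max_in[OF fin] I by auto
      \<comment> \<open>Indices start at 1, so \<open>I\<close> has at most \<open>Max I\<close>
        elements and the hypothesis at \<open>m = Max I\<close> covers it.\<close>
      have "I \<subseteq> {1..Max I}" using I fin by auto
      then have "card I \<le> Max I" using card_mono[of "{1..Max I}" I] by simp
      then have "real (card I) * p \<le> real (Max I) * p" using p by (intro mult_right_mono) auto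
      then have "min 1 (real (card I) * p) \<le> \<rho> * cost I"
        using \<rho>(2)[OF M(2)] False by (simp add: cost_def)
      then show ?thesis using emeasure_bernoulli_some_1(2)[OF p fin]
        unfolding D_def by (meson ennreal_leI order_trans)
    qed (simp add: D_def)
  qed
  have sp: "\<omega> (Suc k) \<in> space ?M" if "\<omega> \<in> space N" for \<omega>
    using that by (auto simp: NS space_PiM[of UNIV "\<lambda>_. ?M"])
  have eq: "{\<omega> \<in> space N. hit \<omega> k \<and> time \<omega> (Suc k) \<le> t}
      = (\<Union>I\<in>Pow {1..n}. C I \<inter> {\<omega> \<in> space N. \<omega> (Suc k) \<in> D I})"
    using answering_subset sp by (auto simp: C_def D_def hit_def)
  have D': "{\<omega> \<in> space N. \<omega> (Suc k) \<in> D I} \<in> sets N" if "I \<in> Pow {1..n}" for I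
    unfolding NS by (rule sets_Collect_single) (use D[OF that] in auto)
  show "{\<omega> \<in> space N. hit \<omega> k \<and> time \<omega> (Suc k) \<le> t} \<in> sets N"
    unfolding eq using C D' by (intro sets.finite_UN) auto
  have indep: "emeasure N (C I \<inter> {\<omega> \<in> space N. \<omega> (Suc k) \<in> D I}) = emeasure N (C I) * emeasure ?M (D I)"
    if I: "I \<in> Pow {1..n}" for I
    unfolding NS
  proof (rule emeasure_past_Int_present[OF _ D(1)[OF I]])
    fix \<omega> \<omega>' :: "nat \<Rightarrow> nat \<Rightarrow> real"
    assume "\<omega>' \<in> space S" "\<And>j. j < Suc k \<Longrightarrow> \<omega> j = \<omega>' j" "\<omega> \<in> C I"
    \<comment> \<open>The state before the answer depends on coins with indices up to
      \<open>k\<close> only; the answer itself reads those with index \<open>Suc k\<close>.\<close>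
    moreover from this have "run A G n \<tau> \<omega> k = run A G n \<tau> \<omega>' k" by (intro run_cong) auto
    note answering_cong[OF this]
    ultimately show "\<omega>' \<in> C I" by (simp add: C_def NS)
  qed (use C NS in simp)
  have sum_eq: "ennreal (\<rho> * (if time \<omega> (Suc k) \<le> t then cost (answering \<omega> k) else 0))
      = (\<Sum>I\<in>Pow {1..n}. ennreal (\<rho> * cost I) * indicator (C I) \<omega>)" if "\<omega> \<in> space N" for \<omega>
  proof -
    have "(\<Sum>I\<in>Pow {1..n}. ennreal (\<rho> * cost I) * indicator (C I) \<omega>)
        = (\<Sum>I\<in>Pow {1..n}. if I = answering \<omega> k then
             ennreal (\<rho> * (if time \<omega> (Suc k) \<le> t then cost (answering \<omega> k) else 0)) else 0)"
      using that by (intro sum.cong refl) (auto simp: C_def indicator_def)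
    then show ?thesis using answering_subset[of \<omega> k] by (simp add: sum.delta)
  qed
  have "(\<lambda>\<omega>. \<Sum>I\<in>Pow {1..n}. ennreal (\<rho> * cost I) * indicator (C I) \<omega>) \<in> borel_measurable N"
    using C by (intro borel_measurable_sum borel_measurable_times_ennreal borel_measurable_indicator) auto
  then show "(\<lambda>\<omega>. ennreal (\<rho> * (if time \<omega> (Suc k) \<le> t then cost (answering \<omega> k) else 0))) \<in> borel_measurable N"
    by (subst measurable_cong[OF sum_eq])
  have "emeasure N {\<omega> \<in> space N. hit \<omega> k \<and> time \<omega> (Suc k) \<le> t}
      \<le> (\<Sum>I\<in>Pow {1..n}. emeasure N (C I \<inter> {\<omega> \<in> space N. \<omega> (Suc k) \<in> D I}))"
    unfolding eq using C D' by (intro emeasure_subadditive_finite) auto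
  also have "\<dots> \<le> (\<Sum>I\<in>Pow {1..n}. ennreal (\<rho> * cost I) * emeasure N (C I))"
    using D(2) by (intro sum_mono) (auto simp: indep mult.commute intro!: mult_left_mono)
  also have "\<dots> = (\<integral>\<^sup>+\<omega>. (\<Sum>I\<in>Pow {1..n}. ennreal (\<rho> * cost I) * indicator (C I) \<omega>) \<partial>N)"
    using C by (subst nn_integral_sum) (auto simp: nn_integral_cmult_indicator)
  also have "\<dots> = (\<integral>\<^sup>+\<omega>. ennreal (\<rho> * (if time \<omega> (Suc k) \<le> t then cost (answering \<omega> k) else 0)) \<partial>N)"
    by (intro nn_integral_cong) (simp add: sum_eq)
  finally show "emeasure N {\<omega> \<in> space N. hit \<omega> k \<and> time \<omega> (Suc k) \<le> t}
      \<le> (\<integral>\<^sup>+\<omega>. ennreal (\<rho> * (if time \<omega> (Suc k) \<le> t then cost (answering \<omega> k) else 0)) \<partial>N)" .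
qed

text \<open>The expected number of hits up to time \<open>t\<close> is at most
  \<open>\<rho> * t \<le> T / 2\<close>, so by Markov's inequality \<open>T\<close> hits occur with
  probability at most one half. With fewer hits the iterates stay in the first \<open>T - 1\<close>
  coordinates.\<close>

lemma undiscovered_probability:
  fixes p \<rho> t :: real
  assumes p: "0 \<le> p" "p \<le> 1" and \<rho>: "0 \<le> \<rho>" "\<And>m. m \<in> {1..n} \<Longrightarrow> min 1 (real m * p) \<le> \<rho> * \<tau> m"
    and t: "0 \<le> t" and T: "2 * (\<rho> * t) \<le> real T" "T \<ge> 1"
  defines "N \<equiv> noise_space (bernoulli_measure p)"
  shows "\<exists>E\<in>sets N. emeasure N E \<ge> ennreal (1/2) \<and>
    (\<forall>\<omega>\<in>E. \<forall>k. time \<omega> k \<le> t \<longrightarrow> iter \<omega> k \<in> Rd (T - 1))"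
proof -
  interpret N: prob_space N unfolding N_def noise_space_def
    by (intro prob_space_PiM prob_space_bernoulli[OF p])
  define B where "B k = {\<omega> \<in> space N. hit \<omega> k \<and> time \<omega> (Suc k) \<le> t}" for k
  have B: "B k \<in> sets N" for k unfolding B_def N_def by (rule emeasure_hit_le[OF p \<rho>])
  \<comment> \<open>An algorithm may make infinitely many queries before \<open>t\<close>, so the
    hits are counted by an extended nonnegative series.\<close>
  define X where "X \<omega> = (\<Sum>k. indicator (B k) \<omega> :: ennreal)" for \<omega>
  have X: "X \<in> borel_measurable N" unfolding X_def using B by measurable
  have bits: "\<forall>k i. \<omega> k i \<in> {0, 1}" if "\<omega> \<in> space N" for \<omega>
    using that by (auto simp: N_def noise_space_def space_PiM PiE_iff)
  let ?w = "\<lambda>\<omega> k. ennreal (\<rho> * (if time \<omega> (Suc k) \<le> t then cost (answering \<omega> k) else 0))"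
  have "(\<integral>\<^sup>+\<omega>. X \<omega> \<partial>N) = (\<Sum>k. \<integral>\<^sup>+\<omega>. indicator (B k) \<omega> \<partial>N)"
    unfolding X_def using B by (intro nn_integral_suminf) auto
  also have "\<dots> = (\<Sum>k. emeasure N (B k))" using B by simp
  also have "\<dots> \<le> (\<Sum>k. \<integral>\<^sup>+\<omega>. ?w \<omega> k \<partial>N)"
    unfolding B_def N_def by (intro suminf_le summableI emeasure_hit_le(2)[OF p \<rho>])
  also have "\<dots> = (\<integral>\<^sup>+\<omega>. (\<Sum>k. ?w \<omega> k) \<partial>N)"
    unfolding N_def by (intro nn_integral_suminf[symmetric] emeasure_hit_le(3)[OF p \<rho>])
  also have "\<dots> \<le> (\<integral>\<^sup>+\<omega>. ennreal (\<rho> * t) \<partial>N)"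
  proof (intro nn_integral_mono suminf_le_const summableI)
    fix \<omega> m assume "\<omega> \<in> space N"
    then have b: "\<forall>k i. \<omega> k i \<in> {0, 1}" by (rule bits)
    have "(\<Sum>k<m. ?w \<omega> k) = ennreal (\<rho> * (\<Sum>k<m. if time \<omega> (Suc k) \<le> t then cost (answering \<omega> k) else 0))"
      unfolding sum_distrib_left
      by (rule sum_ennreal) (use \<rho>(1) cost_nonneg[OF answering_subset(1)] in auto)
    also have "\<dots> \<le> ennreal (\<rho> * t)"
      by (intro ennreal_leI mult_left_mono total_cost_before_le b t \<rho>(1))
    finally show "(\<Sum>k<m. ?w \<omega> k) \<le> ennreal (\<rho> * t)" .
  qed
  finally have EX: "(\<integral>\<^sup>+\<omega>. X \<omega> \<partial>N) \<le> ennreal (\<rho> * t)" by (simp add: N.emeasure_space_1)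
  define F where "F = {\<omega> \<in> space N. real T \<le> X \<omega>}"
  have F: "F \<in> sets N" unfolding F_def using X by measurable
  have "ennreal (real T) * emeasure N F = (\<integral>\<^sup>+\<omega>. ennreal (real T) * indicator F \<omega> \<partial>N)"
    using F by (simp add: nn_integral_cmult_indicator)
  also have "\<dots> \<le> (\<integral>\<^sup>+\<omega>. X \<omega> \<partial>N)"
    by (intro nn_integral_mono) (auto simp: F_def indicator_def)
  also note EX
  also have "ennreal (\<rho> * t) \<le> ennreal (real T / 2)" using T by (intro ennreal_leI) simp
  finally have "ennreal (real T * measure N F) \<le> ennreal (real T / 2)"
    by (simp add: N.emeasure_eq_measure ennreal_mult)
  then have "real T * measure N F \<le> real T / 2" by simp
  then have PF: "measure N F \<le> 1/2" using T(2) by (simp add: field_simps)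
  show ?thesis
  proof (intro bexI[of _ "space N - F"] conjI ballI allI impI)
    show "space N - F \<in> sets N" using F by simp
    have "measure N (space N - F) \<ge> 1/2" using PF F by (simp add: N.prob_compl)
    then show "emeasure N (space N - F) \<ge> ennreal (1/2)" by (simp add: N.emeasure_eq_measure ennreal_leI del: ennreal_half)
    fix \<omega> k assume \<omega>: "\<omega> \<in> space N - F" and k: "time \<omega> k \<le> t"
    then have b: "\<forall>k i. \<omega> k i \<in> {0, 1}" by (intro bits) simp
    \<comment> \<open>A hit before step \<open>k\<close> happens no later than
      \<open>time \<omega> k \<le> t\<close>, hence is counted in \<open>X\<close>.\<close>
    have "\<omega> \<in> B j" if "j < k" "hit \<omega> j" for j
      using time_mono[OF b, of "Suc j" k] that k \<omega> by (auto simp: B_def)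
    then have "ennreal (real (card {j. j < k \<and> hit \<omega> j})) = (\<Sum>j\<in>{j. j < k \<and> hit \<omega> j}. indicator (B j) \<omega>)"
      by (simp add: ennreal_of_nat_eq_real_of_nat)
    also have "\<dots> \<le> X \<omega>" unfolding X_def by (intro sum_le_suminf summableI) auto
    also have "\<dots> < ennreal (real T)" using \<omega> by (auto simp: F_def)
    finally have "card {j. j < k \<and> hit \<omega> j} < T" by (simp add: ennreal_less_iff)
    then have "Rd (card {j. j < k \<and> hit \<omega> j}) \<subseteq> Rd (T - 1)" by (auto simp: Rd_def)
    then show "iter \<omega> k \<in> Rd (T - 1)" using supported_below[OF b, of k] by blast
  qed
qed

end

section \<open>The lower bound\<close>

definition progress :: "vec \<Rightarrow> nat" where
  "progress x = (LEAST m. x \<in> Rd m)"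

text \<open>\<open>progress x\<close> is the first index after the support of \<open>x\<close>, the
  only one beyond it that a chain gradient can reveal. A coin of mean \<open>p\<close> divided by
  \<open>p\<close> keeps the estimate unbiased.\<close>

definition masked_grad :: "real \<Rightarrow> (vec \<Rightarrow> vec) \<Rightarrow> vec \<Rightarrow> real \<Rightarrow> vec" where
  "masked_grad p g x \<xi> i = g x i * (if i = progress x then \<xi> / p else 1)"

lemma progress_Rd:
  assumes "x \<in> Rd m" shows "x \<in> Rd (progress x)" "progress x \<le> m"
  using assms unfolding progress_def by (auto intro: LeastI Least_le)

text \<open>If \<open>progress x = m\<close>, the coin guards the new coordinate \<open>m\<close>;
  if \<open>progress x < m\<close>, the gradient already vanishes from index \<open>m\<close>
  on.\<close>

lemma masked_grad_reveal:
  assumes g: "\<And>x m i. x \<in> Rd m \<Longrightarrow> m < i \<Longrightarrow> g x i = 0" and x: "x \<in> Rd m"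
  shows "masked_grad p g x 0 \<in> Rd m" "masked_grad p g x 1 \<in> Rd (Suc m)"
proof -
  have "masked_grad p g x \<xi> i = 0" if "i \<ge> m" "i \<noteq> m \<or> \<xi> = 0" for \<xi> i
    using g[OF progress_Rd(1)[OF x], of i] progress_Rd(2)[OF x] that
    by (cases "i = progress x") (auto simp: masked_grad_def)
  then show "masked_grad p g x 0 \<in> Rd m" "masked_grad p g x 1 \<in> Rd (Suc m)"
    by (auto simp: Rd_def)
qed

text \<open>Only one coordinate is random, and its variance is its squared value times
  \<open>(1 - p) / p\<close>.\<close>

lemma masked_grad_admissible:
  assumes p: "0 < p" "p \<le> 1" and gd: "\<And>x. x \<in> Rd d \<Longrightarrow> g x \<in> Rd d"
    and B: "\<And>x i. \<bar>g x i\<bar> \<le> B" and var: "B^2 * (1 - p) \<le> \<sigma>2 * p" and \<sigma>2: "0 \<le> \<sigma>2"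
  shows "admissible_oracle d \<sigma>2 g (bernoulli_measure p) (masked_grad p g)"
  unfolding admissible_oracle_def
proof (intro conjI ballI allI impI)
  show "prob_space (bernoulli_measure p)" using p by (intro prob_space_bernoulli) auto
  fix x assume x: "x \<in> Rd d"
  have integrable: "integrable (bernoulli_measure p) h" for h :: "real \<Rightarrow> real"
    using p by (intro integral_bernoulli) auto
  have integral: "(\<integral>\<xi>. h \<xi> \<partial>bernoulli_measure p) = (1 - p) * h 0 + p * h 1" for h :: "real \<Rightarrow> real"
    using p by (intro integral_bernoulli) auto
  show "masked_grad p g x \<xi> \<in> Rd d" for \<xi>
    using gd[OF x] by (auto simp: Rd_def masked_grad_def)
  show "integrable (bernoulli_measure p) (\<lambda>\<xi>. masked_grad p g x \<xi> i)" for i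
    by (rule integrable)
  show "(\<integral>\<xi>. masked_grad p g x \<xi> i \<partial>bernoulli_measure p) = g x i" for i
    using p by (simp add: integral masked_grad_def algebra_simps)
  show "integrable (bernoulli_measure p) (\<lambda>\<xi>. (normd d (\<lambda>i. masked_grad p g x \<xi> i - g x i))^2)"
    by (rule integrable)
  \<comment> \<open>If the last coordinate of \<open>x\<close> is nonzero, then
    \<open>progress x = d\<close> and nothing is masked.\<close>
  define v where "v = (if progress x < d then (g x (progress x))^2 else 0)"
  have v: "v \<le> B^2" using power_mono[OF B[of x "progress x"], of 2] by (auto simp: v_def)
  have "(normd d (\<lambda>i. masked_grad p g x \<xi> i - g x i))^2 = v * (\<xi> / p - 1)^2" for \<xi>
  proof -
    have "(normd d (\<lambda>i. masked_grad p g x \<xi> i - g x i))^2 = (\<Sum>i<d. (masked_grad p g x \<xi> i - g x i)^2)"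
      by (simp add: normd_def sum_nonneg)
    also have "\<dots> = (\<Sum>i<d. if i = progress x then (g x (progress x))^2 * (\<xi> / p - 1)^2 else 0)"
      by (intro sum.cong refl) (auto simp: masked_grad_def power_mult_distrib[symmetric] right_diff_distrib)
    finally show ?thesis by (simp add: v_def)
  qed
  then have "(\<integral>\<xi>. (normd d (\<lambda>i. masked_grad p g x \<xi> i - g x i))^2 \<partial>bernoulli_measure p)
      = (\<integral>\<xi>. v * (\<xi> / p - 1)^2 \<partial>bernoulli_measure p)" by simp
  also have "\<dots> = (1 - p) * (v * (0 / p - 1)^2) + p * (v * (1 / p - 1)^2)" by (rule integral)
  also have "\<dots> = v * ((1 - p) / p)"
    using p by (simp add: field_simps power2_eq_square)
  also have "\<dots> \<le> B^2 * ((1 - p) / p)"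
    using v p by (intro mult_right_mono) auto
  also have "\<dots> \<le> \<sigma>2" using var p by (simp add: field_simps)
  finally show "(\<integral>\<xi>. (normd d (\<lambda>i. masked_grad p g x \<xi> i - g x i))^2 \<partial>bernoulli_measure p) \<le> \<sigma>2" .
qed

subsection \<open>Choice of the parameters\<close>

text \<open>The scale \<open>a\<close> makes the squared gradient at least \<open>4 * \<epsilon>\<close> before the last coordinate is
  discovered, and \<open>b\<close> makes the gradient \<open>L\<close>-Lipschitz; then \<open>\<Delta>\<close> allows about \<open>L * \<Delta> / (1536 * \<epsilon>)\<close>
  coordinates. The constant 3545088 is \<open>2 * 577 * 3072\<close>.\<close>
lemma hard_instance:
  fixes \<sigma>2 L \<Delta> \<epsilon> :: real and \<tau> :: "nat \<Rightarrow> real" and A :: "nat \<Rightarrow> alg"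
  assumes n: "n \<ge> 1" and \<sigma>2: "\<sigma>2 > 0" and \<tau>: "\<And>i. i \<in> {1..n} \<Longrightarrow> 0 < \<tau> i"
    and L: "L > 0" and \<Delta>: "\<Delta> > 0" and \<epsilon>: "0 < \<epsilon>" "\<epsilon> \<le> 1/1536 * L * \<Delta>"
    and A: "\<And>d. is_algorithm d (A d)" "\<And>d. zero_respecting d (A d)"
  defines "W \<equiv> Min ((\<lambda>m. \<tau> m * (L * \<Delta> / \<epsilon> + \<sigma>2 * L * \<Delta> / (real m * \<epsilon>^2))) ` {1..n})"
  shows "\<exists>d f g D0 G. F_class d \<Delta> L f g \<and> admissible_oracle d \<sigma>2 g D0 G \<and>
    expected_inf_sqgrad d (A d) g D0 G n \<tau> (1/3545088 * W) > ennreal \<epsilon>"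
proof -
  define a b T where "a = 8 * sqrt \<epsilon>" and "b = 24 * a / L" and "T = nat \<lfloor>L * \<Delta> / (1536 * \<epsilon>)\<rfloor>"
  define g where "g x i = a * chain' T (\<lambda>i. x i / b) i" for x i
  \<comment> \<open>Gradient entries are at most \<open>3 * a\<close>, whose square is
    \<open>576 * \<epsilon>\<close>, so this bias keeps the variance below \<open>\<sigma>2\<close>.
    At the cap 1 there is no noise.\<close>
  define p where "p = min 1 (576 * \<epsilon> / \<sigma>2)"
  define R where "R = L * \<Delta> / \<epsilon>"
  have a: "a > 0" "a^2 = 64 * \<epsilon>" using \<epsilon> by (simp_all add: a_def power_mult_distrib)
  have b: "b > 0" using a L by (simp add: b_def)
  have ab: "a * b = 1536 * \<epsilon> / L" using a by (simp add: b_def power2_eq_square)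
  have R: "R > 0" using L \<Delta> \<epsilon> by (simp add: R_def)
  have y: "1 \<le> R / 1536" using L \<Delta> \<epsilon> by (simp add: R_def field_simps)
  have T_def': "T = nat \<lfloor>R / 1536\<rfloor>" by (simp add: T_def R_def mult.commute)
  have "real T = real_of_int \<lfloor>R / 1536\<rfloor>" using R by (simp add: T_def')
  moreover have "1 \<le> \<lfloor>R / 1536\<rfloor>" using y by (simp add: le_floor_iff)
  \<comment> \<open>A number that is at least 1 is less than twice its floor, whence the lower bound
    \<open>R / 3072\<close>.\<close>
  ultimately have T: "T \<ge> 1" "real T \<le> R / 1536" "R / 3072 \<le> real T"
    using floor_correct[of "R / 1536"] by linarith+
  have p: "0 < p" "p \<le> 1" "576 * \<epsilon> * (1 - p) \<le> \<sigma>2 * p" "p * \<sigma>2 \<le> 576 * \<epsilon>"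
  proof -
    show p0: "0 < p" and "p \<le> 1" using \<epsilon> \<sigma>2 by (auto simp: p_def)
    show "p * \<sigma>2 \<le> 576 * \<epsilon>" using \<sigma>2 by (auto simp: p_def min_def field_simps)
    show "576 * \<epsilon> * (1 - p) \<le> \<sigma>2 * p"
    proof (cases "p = 1")
      case False
      then have "\<sigma>2 * p = 576 * \<epsilon>" using \<sigma>2 by (auto simp: p_def min_def split: if_splits)
      then show ?thesis using \<epsilon> p0 by (simp add: algebra_simps)
    qed (use \<sigma>2 in simp)
  qed
  have gd: "g x \<in> Rd T" for x by (simp add: g_def Rd_def chain'_def)
  have g_chain: "g x i = 0" if "x \<in> Rd m" "m < i" for x m i
    using chain'_eq_0[of m "\<lambda>i. x i / b" i T] that by (simp add: g_def Rd_def)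
  have g_bound: "\<bar>g x i\<bar> \<le> 3 * a" for x i
    using chain'_bounded[of T "\<lambda>i. x i / b" i] a by (simp add: g_def abs_mult)
  have g_large: "(normd T (g x))^2 \<ge> 4 * \<epsilon>" if "x \<in> Rd (T - 1)" for x
  proof -
    have "(1/4)^2 \<le> (\<Sum>j<T. (chain' T (\<lambda>i. x i / b) j)^2)"
      using that T by (intro chain'_large) (auto simp: Rd_def)
    then have "a^2 * (1/4)^2 \<le> a^2 * (\<Sum>j<T. (chain' T (\<lambda>i. x i / b) j)^2)"
      by (intro mult_left_mono) auto
    also have "\<dots> = (normd T (g x))^2"
      by (simp add: normd_def sum_nonneg g_def power_mult_distrib sum_distrib_left)
    finally show ?thesis by (simp add: a power_divide)
  qed
  have F: "F_class T \<Delta> L (\<lambda>x. a * b * chain T (\<lambda>i. x i / b)) g"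
    unfolding g_def
  proof (rule scaled_chain_F_class[OF a(1) b])
    show "24 * a = L * b" using L by (simp add: b_def)
    have "a * b * real T \<le> a * b * (R / 1536)"
      using T a b by (intro mult_left_mono) auto
    also have "\<dots> = \<Delta>" using L \<epsilon> by (simp add: ab R_def)
    finally show "a * b * real T \<le> \<Delta>" .
  qed
  have adm: "admissible_oracle T \<sigma>2 g (bernoulli_measure p) (masked_grad p g)"
    using p \<sigma>2 by (intro masked_grad_admissible[where B = "3 * a"] gd g_bound) (simp_all add: power_mult_distrib a)
  interpret sync_protocol T n \<tau> "A T" "masked_grad p g"
  proof
    show "masked_grad p g x \<xi> \<in> Rd T" for x \<xi>
      using gd[of x] by (auto simp: Rd_def masked_grad_def)
    show "masked_grad p g x 0 \<in> Rd m" "masked_grad p g x 1 \<in> Rd (Suc m)" if "x \<in> Rd m" for x m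
      by (rule masked_grad_reveal[OF _ that], erule (1) g_chain)+
  qed (use A \<tau> in \<open>auto intro: less_imp_le\<close>)
  let ?V = "\<lambda>m. \<tau> m * (L * \<Delta> / \<epsilon> + \<sigma>2 * L * \<Delta> / (real m * \<epsilon>^2))"
  have V: "?V m = \<tau> m * R * (1 + \<sigma>2 / (real m * \<epsilon>))" for m
    using \<epsilon> by (simp add: R_def power2_eq_square distrib_left add_divide_distrib mult_ac)
  have "W \<in> ?V ` {1..n}" unfolding W_def using n by (intro Min_in) auto
  then obtain m0 where m0: "m0 \<in> {1..n}" "W = ?V m0" by blast
  have "0 < 1 + \<sigma>2 / (real m0 * \<epsilon>)" using \<sigma>2 \<epsilon> by (intro add_pos_nonneg) auto
  then have W: "W > 0" unfolding m0(2) V using \<tau>[OF m0(1)] R by simp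
  have WV: "W \<le> ?V m" if "m \<in> {1..n}" for m unfolding W_def using that by (intro Min_le) auto
  \<comment> \<open>577 is \<open>1 + 576\<close>: multiplied by \<open>min 1 (real m * p)\<close>,
    the two summands of \<open>1 + \<sigma>2 / (real m * \<epsilon>)\<close> are at most 1 and
    \<open>p * \<sigma>2 / \<epsilon> \<le> 576\<close>.\<close>
  define \<rho> where "\<rho> = 577 * R / W"
  have \<rho>0: "\<rho> \<ge> 0" using R W by (simp add: \<rho>_def)
  have \<rho>: "min 1 (real m * p) \<le> \<rho> * \<tau> m" if m: "m \<in> {1..n}" for m
  proof -
    let ?q = "min 1 (real m * p)"
    have q0: "0 \<le> ?q" using p by simp
    have "?q * (\<sigma>2 / (real m * \<epsilon>)) \<le> real m * p * (\<sigma>2 / (real m * \<epsilon>))"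
      using \<sigma>2 \<epsilon> by (intro mult_right_mono) auto
    also have "\<dots> = p * \<sigma>2 / \<epsilon>" using m by simp
    also have "\<dots> \<le> 576" using p(4) \<epsilon> by (simp add: field_simps)
    finally have q: "?q * (1 + \<sigma>2 / (real m * \<epsilon>)) \<le> 577" by (simp add: distrib_left)
    have "?q * W \<le> ?q * ?V m" using WV[OF m] q0 by (intro mult_left_mono)
    also have "\<dots> = \<tau> m * R * (?q * (1 + \<sigma>2 / (real m * \<epsilon>)))" unfolding V by (simp add: algebra_simps)
    also have "\<dots> \<le> \<tau> m * R * 577" using q \<tau>[OF m] R by (intro mult_left_mono) auto
    finally show ?thesis using W by (simp add: \<rho>_def field_simps)
  qed
  let ?t = "1/3545088 * W"
  let ?N = "noise_space (bernoulli_measure p)"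
  have t0: "0 \<le> ?t" using W by simp
  have "2 * (\<rho> * ?t) = R / 3072" using W by (simp add: \<rho>_def)
  then have "2 * (\<rho> * ?t) \<le> real T" using T(3) by simp
  then obtain E where E: "E \<in> sets ?N" "ennreal (1/2) \<le> emeasure ?N E"
    "\<And>\<omega> k. \<omega> \<in> E \<Longrightarrow> time \<omega> k \<le> ?t \<Longrightarrow> iter \<omega> k \<in> Rd (T - 1)"
    using undiscovered_probability[OF less_imp_le[OF p(1)] p(2) \<rho>0 \<rho> t0 _ T(1)] by blast
  \<comment> \<open>Squared gradients of at least \<open>4 * \<epsilon>\<close> on an event of
    probability one half contribute \<open>2 * \<epsilon>\<close>, whence the strict
    inequality.\<close>
  have "ennreal \<epsilon> < ennreal (4 * \<epsilon> * (1/2))" using \<epsilon> by (intro ennreal_lessI) auto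
  also have "\<dots> = ennreal (4 * \<epsilon>) * ennreal (1/2)" using \<epsilon> by (intro ennreal_mult) auto
  also have "\<dots> \<le> ennreal (4 * \<epsilon>) * emeasure ?N E" using E(2) by (rule mult_left_mono) simp
  also have "\<dots> = (\<integral>\<^sup>+\<omega>. ennreal (4 * \<epsilon>) * indicator E \<omega> \<partial>?N)"
    using E(1) by (simp add: nn_integral_cmult_indicator)
  also have "\<dots> \<le> expected_inf_sqgrad T (A T) g (bernoulli_measure p) (masked_grad p g) n \<tau> ?t"
    unfolding expected_inf_sqgrad_def
  proof (rule nn_integral_mono)
    fix \<omega>
    have "4 * \<epsilon> \<le> (INF k\<in>{k. time \<omega> k \<le> ?t}. (normd T (g (iter \<omega> k)))^2)" if "\<omega> \<in> E"
    proof (rule cINF_greatest)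
      \<comment> \<open>Step 0 has time 0, so the infimum ranges over a nonempty set.\<close>
      have "time \<omega> 0 \<le> ?t" using t0 by (simp add: iterate_t_def)
      then show "{k. time \<omega> k \<le> ?t} \<noteq> {}" by blast
    qed (use E(3)[OF that] g_large in blast)
    then show "ennreal (4 * \<epsilon>) * indicator E \<omega>
        \<le> ennreal (INF k\<in>{k. time \<omega> k \<le> ?t}. (normd T (g (iter \<omega> k)))^2)"
      by (auto simp: indicator_def intro: ennreal_leI)
  qed
  finally show ?thesis using F adm by blast
qed

theorem mainTheorem10:
  shows "\<exists>c::real>0. \<exists>c'::real>0. \<forall>(n::nat) (\<sigma>2::real) (\<tau>::nat \<Rightarrow> real) (L::real) (\<Delta>::real) (\<epsilon>::real) (A::nat \<Rightarrow> alg).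
    n \<ge> 1 \<and> \<sigma>2 > 0 \<and> 0 < \<tau> 1 \<and> (\<forall>i j. 1 \<le> i \<and> i \<le> j \<and> j \<le> n \<longrightarrow> \<tau> i \<le> \<tau> j) \<and>
    L > 0 \<and> \<Delta> > 0 \<and> 0 < \<epsilon> \<and> \<epsilon> \<le> c' * L * \<Delta> \<and>
    (\<forall>d. is_algorithm d (A d) \<and> zero_respecting d (A d))
    \<longrightarrow> (\<exists>(d::nat) (f::vec \<Rightarrow> real) (g::vec \<Rightarrow> vec) (D0::real measure) (G::vec \<Rightarrow> real \<Rightarrow> vec).
           F_class d \<Delta> L f g \<and> admissible_oracle d \<sigma>2 g D0 G \<and>
           expected_inf_sqgrad d (A d) g D0 G n \<tau>
             (c * Min ((\<lambda>m. \<tau> m * (L * \<Delta> / \<epsilon> + \<sigma>2 * L * \<Delta> / (real m * \<epsilon>^2))) ` {1..n}))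
           > ennreal \<epsilon>)"
proof (intro exI[of _ "1/3545088"] exI[of _ "1/1536"] conjI allI impI, goal_cases)
  case (3 n \<sigma>2 \<tau> L \<Delta> \<epsilon> A)
  then have "0 < \<tau> i" if "i \<in> {1..n}" for i
    using that by (force intro: less_le_trans[of 0 "\<tau> 1"])
  then show ?case using 3 by (intro hard_instance) auto
qed auto

end
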